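(* Let $w$ be a combinatorial $r$-pattern of length $k$. Then the sequence of random variables $\{L_n^w\}_{n\geq 1}$ satisfies a clt; that is, there exist $\mu\in\mathbb{R}$ and $\sigma\in\mathbb{R}$ with $\sigma>0$ such that for every $t\in\mathbb{R}$, $$\lim_{n\to\infty}\mathrm{Prob}\big(L_n^w-\mu n<t\sigma\sqrt{n}\big)=\Phi(t),\qquad \Phi(t)=\frac{1}{\sqrt{2\pi}}\int_{-\infty}^{t}e^{-u^2/2}\,du .$$
   Context: Let $S_r$ denote the symmetric group on $r$ letters. An $r$-pattern of length $k$ is a map $w:\mathbb{Z}/k\mathbb{Z}\to 2^{S_r}\setminus\{\emptyset\}$, i.e. it assigns to each residue class $[a]$ a nonempty set $w([a])$ of permutations of $\{1,\dots,r\}$. A finite sequence $\sigma=(\sigma(1),\dots,\sigma(m))$ of real numbers follows $w$ if for every $j\geq 0$ with $j+r\leq m$ the values $\sigma(j+1),\dots,\sigma(j+r)$ are distinct and the permutation $\rho\in S_r$ defined by $\rho(i)<\rho(i')\iff\sigma(j+i)<\sigma(j+i')$ belongs to $w([j])$. For sequences $\sigma\in\mathbb{R}^a,\tau\in\mathbb{R}^b$ their product is the concatenation $\sigma\tau=(\sigma(1),\dots,\sigma(a),\tau(1),\dots,\tau(b))$. The pattern $w$ (of length $k$) is called combinatorial if for every pair of real sequences $\sigma,\tau$ of lengths $a,b$ that both follow $w$, the product $\sigma\tau$ has a subsequence of length at least $a+b-k$ which also follows $w$. Equip the symmetric group $S_n$ with the uniform probability measure, regarding each $\sigma\in S_n$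 as the sequence $(\sigma(1),\dots,\sigma(n))\in[1,n]^n\subseteq\mathbb{R}^n$. Define $L_n^w:S_n\to\mathbb{Z}_{\geq 0}$ by $L_n^w(\sigma)=\max\{m:\exists\,\tau:[1,m]\to[1,n]\text{ strictly increasing with }\sigma\circ\tau\text{ following }w\}$, the length of the longest subsequence of $\sigma$ following $w$. A sequence $\{f_n\}$ of real-valued random variables satisfies a clt if there are $\mu\in\mathbb{R}$ and $\sigma>0$ with $\lim_{n\to\infty}\mathrm{Prob}(f_n-\mu n<t\sigma\sqrt{n})=\Phi(t)$ for all $t\in\mathbb{R}$, where $\Phi$ is the standard normal cumulative distribution function.
   Formalization: Added hypothesis: arbitrarily long sequences follow w, and some w([a]) is not all of S_r. Without it the claim fails (r = k = 1, w = {id} gives L_n = n; other patterns give bounded L_n). The condition is necessary for the clt, so no valid case is lost. *)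

theory Defs
  imports "HOL-Probability.Probability" "HOL-Combinatorics.Permutations" "HOL-Library.Sublist"
    "HOL-Real_Asymp.Real_Asymp"
begin

section \<open>Patterns\<close>

text \<open>
  The residue class of \<open>j\<close> modulo \<open>k\<close> is represented by \<open>j mod k\<close>, so only the values of \<open>w\<close>
  at \<open>0, \<dots>, k - 1\<close> matter.
\<close>

definition is_pattern :: "nat \<Rightarrow> nat \<Rightarrow> (nat \<Rightarrow> (nat \<Rightarrow> nat) set) \<Rightarrow> bool" where
  "is_pattern r k w \<longleftrightarrow>
     k > 0 \<and> (\<forall>a<k. w a \<noteq> {} \<and> w a \<subseteq> {\<rho>. \<rho> permutes {1..r}})"

text \<open>
  Lists are indexed from 0: the term written \<open>\<sigma>(j + i)\<close> in 1-based notation is \<open>s ! (j + i - 1)\<close>.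
  The window is distinct, so at most one permutation of \<open>{1..r}\<close> satisfies the order condition.
\<close>

definition follows ::
    "nat \<Rightarrow> nat \<Rightarrow> (nat \<Rightarrow> (nat \<Rightarrow> nat) set) \<Rightarrow> real list \<Rightarrow> bool" where
  "follows r k w s \<longleftrightarrow>
     (\<forall>j. j + r \<le> length s \<longrightarrow>
        inj_on (\<lambda>i. s ! (j + i - 1)) {1..r} \<and>
        (\<exists>\<rho> \<in> w (j mod k). \<forall>i\<in>{1..r}. \<forall>i'\<in>{1..r}.
            \<rho> i < \<rho> i' \<longleftrightarrow> s ! (j + i - 1) < s ! (j + i' - 1)))"

definition combinatorial :: "nat \<Rightarrow> nat \<Rightarrow> (nat \<Rightarrow> (nat \<Rightarrow> nat) set) \<Rightarrow> bool" where
  "combinatorial r k w \<longleftrightarrow>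
     (\<forall>s t. follows r k w s \<longrightarrow> follows r k w t \<longrightarrow>
        (\<exists>u. subseq u (s @ t) \<and> follows r k w u \<and> length s + length t \<le> length u + k))"

definition longest_following ::
    "nat \<Rightarrow> nat \<Rightarrow> (nat \<Rightarrow> (nat \<Rightarrow> nat) set) \<Rightarrow> nat \<Rightarrow> (nat \<Rightarrow> nat) \<Rightarrow> nat" where
  "longest_following r k w n \<sigma> =
     Max {m. \<exists>\<tau>. \<tau> ` {1..m} \<subseteq> {1..n} \<and> strict_mono_on {1..m} \<tau> \<and>
            follows r k w (map (\<lambda>i. real (\<sigma> (\<tau> i))) [1..<Suc m])}"

section \<open>The central limit theorem property\<close>

definition uniform_perm :: "nat \<Rightarrow> (nat \<Rightarrow> nat) measure" where
  "uniform_perm n = measure_pmf (pmf_of_set {\<sigma>. \<sigma> permutes {1..n}})"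

text \<open>\<open>cdf std_normal_distribution\<close> is the standard normal distribution function.\<close>

definition satisfies_clt :: "(nat \<Rightarrow> 'a measure) \<Rightarrow> (nat \<Rightarrow> 'a \<Rightarrow> real) \<Rightarrow> bool" where
  "satisfies_clt M f \<longleftrightarrow>
     (\<exists>\<mu> \<sigma>. \<sigma> > 0 \<and>
        (\<forall>t. (\<lambda>n. measure (M n) {x \<in> space (M n). f n x - \<mu> * real n < t * \<sigma> * sqrt (real n)})
               \<longlonglongrightarrow> cdf std_normal_distribution t))"

section \<open>Degenerate patterns\<close>

text \<open>
  A clt requires a strictly positive variance constant. It therefore fails for a pattern whose
  following sequences have bounded length, and for the pattern that allows every permutation
  everywhere, although both kinds of pattern can be combinatorial (\<open>degenerate_example_total\<close>,
  \<open>degenerate_example_bounded\<close>). The predicate \<open>nondegenerate\<close> excludes exactly these two cases;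
  \<open>clt_imp_nondegenerate\<close> shows that it is a necessary condition for the clt.
\<close>

definition nondegenerate :: "nat \<Rightarrow> nat \<Rightarrow> (nat \<Rightarrow> (nat \<Rightarrow> nat) set) \<Rightarrow> bool" where
  "nondegenerate r k w \<longleftrightarrow>
     (\<forall>N. \<exists>s. length s \<ge> N \<and> follows r k w s) \<and>
     (\<exists>a<k. w a \<noteq> {\<rho>. \<rho> permutes {1..r}})"

lemma measure_std_normal_pos:
  assumes S: "S \<in> sets borel" and pos: "emeasure lborel S \<noteq> 0"
  shows "0 < measure std_normal_distribution S"
proof (rule ccontr)
  assume "\<not> 0 < measure std_normal_distribution S"
  then have 0: "measure std_normal_distribution S = 0"
    by (simp add: zero_less_measure_iff)
  interpret prob_space std_normal_distribution
    by (intro prob_space_normal_density) simp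
  have "emeasure std_normal_distribution S = 0"
    using 0 by (simp add: emeasure_eq_measure)
  then have "S \<in> null_sets std_normal_distribution" using S by (auto simp: null_sets_def)
  then have "AE x in lborel. x \<in> S \<longrightarrow> ennreal (std_normal_density x) = 0"
    by (subst (asm) null_sets_density_iff) auto
  moreover have "std_normal_density x > 0" for x by (simp add: normal_density_pos)
  ultimately have "AE x in lborel. x \<notin> S"
    by (auto simp: ennreal_eq_0_iff not_le[symmetric] elim!: AE_mp)
  then have "S \<in> null_sets lborel" using S
    by (subst AE_iff_null_sets) auto
  then show False using pos by (simp add: null_sets_def)
qed

lemma cdf_std_normal_pos: "0 < cdf std_normal_distribution t"
  unfolding cdf_def
proof (rule measure_std_normal_pos)
  have "emeasure lborel {t-1..t} \<le> emeasure lborel {..t}"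
    by (intro emeasure_mono) auto
  then show "emeasure lborel {..t} \<noteq> 0" by auto
qed simp

lemma cdf_std_normal_less_1: "cdf std_normal_distribution t < 1"
proof -
  interpret prob_space std_normal_distribution
    by (intro prob_space_normal_density) simp
  have "emeasure lborel {t+1..t+2} \<le> emeasure lborel (- {..t})"
    by (intro emeasure_mono) auto
  then have "emeasure lborel (- {..t}) \<noteq> 0" by auto
  then have "0 < measure std_normal_distribution (- {..t})"
    by (intro measure_std_normal_pos) auto
  also have "measure std_normal_distribution (- {..t}) = 1 - cdf std_normal_distribution t"
    using prob_compl[of "{..t}"] by (simp add: cdf_def Compl_eq_Diff_UNIV)
  finally show ?thesis by simp
qed

lemma not_clt_if_nearly_linear:
  fixes c B :: real
  assumes near: "\<And>n \<sigma>. \<sigma> permutes {1..n} \<Longrightarrow> \<bar>f n \<sigma> - c * real n\<bar> \<le> B"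
  shows "\<not> satisfies_clt uniform_perm f"
proof
  assume "satisfies_clt uniform_perm f"
  then obtain \<mu> s where s: "s > 0" and lim: "\<And>t. (\<lambda>n. measure (uniform_perm n)
      {x \<in> space (uniform_perm n). f n x - \<mu> * real n < t * s * sqrt (real n)})
        \<longlonglongrightarrow> cdf std_normal_distribution t" (is "\<And>t. (\<lambda>n. ?P n t) \<longlonglongrightarrow> _")
    unfolding satisfies_clt_def by blast
  have supp: "set_pmf (pmf_of_set {\<sigma>. \<sigma> permutes {1..n}}) = {\<sigma>. \<sigma> permutes {1..n}}" for n :: nat
    proof (rule set_pmf_of_set)
    show "{\<sigma>. \<sigma> permutes {1..n}} \<noteq> {}" using permutes_id by blast
    show "finite {\<sigma>. \<sigma> permutes {1..n}}" by (rule finite_permutations) simp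
  qed
  show False
  proof (cases "c \<le> \<mu>")
    case True
    have "filterlim (\<lambda>n. s * sqrt (real n)) at_top sequentially"
      using s by real_asymp
    then have "\<forall>\<^sub>F n in sequentially. B < s * sqrt (real n)"
      by (simp add: filterlim_at_top_dense)
    then have "\<forall>\<^sub>F n in sequentially. ?P n 1 = 1"
    proof eventually_elim
      case (elim n)
      have "AE x in uniform_perm n. f n x - \<mu> * real n < 1 * s * sqrt (real n)"
        unfolding uniform_perm_def AE_measure_pmf_iff supp
      proof safe
        fix x :: "nat \<Rightarrow> nat" assume "x permutes {1..n}"
        from near[OF this] mult_right_mono[OF True, of "real n"] elim
        show "f n x - \<mu> * real n < 1 * s * sqrt (real n)" by auto
      qed
      then show ?case
        unfolding uniform_perm_def by (subst measure_pmf.prob_Collect_eq_1) auto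
    qed
    then have "(\<lambda>n. ?P n 1) \<longlonglongrightarrow> 1" by (rule tendsto_eventually)
    from LIMSEQ_unique[OF this lim] cdf_std_normal_less_1[of 1] show False by simp
  next
    case False
    have "filterlim (\<lambda>n. (c - \<mu>) * real n) at_top sequentially"
      using False by real_asymp
    then have "\<forall>\<^sub>F n in sequentially. B < (c - \<mu>) * real n"
      by (simp add: filterlim_at_top_dense)
    then have "\<forall>\<^sub>F n in sequentially. ?P n 0 = 0"
    proof eventually_elim
      case (elim n)
      have "AE x in uniform_perm n. \<not> f n x - \<mu> * real n < 0 * s * sqrt (real n)"
        unfolding uniform_perm_def AE_measure_pmf_iff supp
      proof safe
        fix x :: "nat \<Rightarrow> nat"
        assume "x permutes {1..n}" and less: "f n x - \<mu> * real n < 0 * s * sqrt (real n)"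
        from near[OF this(1)] less elim show False by (auto simp: algebra_simps)
      qed
      then show ?case
        unfolding uniform_perm_def by (subst measure_pmf.prob_Collect_eq_0) auto
    qed
    then have "(\<lambda>n. ?P n 0) \<longlonglongrightarrow> 0" by (rule tendsto_eventually)
    from LIMSEQ_unique[OF this lim] cdf_std_normal_pos[of 0] show False by simp
  qed
qed

lemma ex_standardization:
  fixes x :: "nat \<Rightarrow> real"
  assumes inj: "inj_on x {1..r}"
  shows "\<exists>\<rho>. \<rho> permutes {1..r} \<and> (\<forall>i\<in>{1..r}. \<forall>i'\<in>{1..r}. \<rho> i < \<rho> i' \<longleftrightarrow> x i < x i')"
proof -
  define D where "D i = {l\<in>{1..r}. x l \<le> x i}" for i
  define \<rho> where "\<rho> i = (if i \<in> {1..r} then card (D i) else i)" for i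
  have fin: "finite (D i)" for i by (simp add: D_def)
  have less: "\<rho> i < \<rho> i'" if "i \<in> {1..r}" "i' \<in> {1..r}" "x i < x i'" for i i'
  proof -
    have "D i \<subseteq> D i'" "i' \<in> D i'" "i' \<notin> D i" using that by (auto simp: D_def)
    then have "D i \<subset> D i'" by blast
    then show ?thesis using that by (simp add: \<rho>_def psubset_card_mono fin)
  qed
  have iff: "\<rho> i < \<rho> i' \<longleftrightarrow> x i < x i'" if "i \<in> {1..r}" "i' \<in> {1..r}" for i i'
    using less[OF that] less[OF that(2,1)] inj_onD[OF inj _ that]
    by (metis less_irrefl linorder_cases order_less_asym)
  have "inj_on \<rho> {1..r}"
  proof (rule inj_onI)
    fix i i' assume *: "i \<in> {1..r}" "i' \<in> {1..r}" "\<rho> i = \<rho> i'"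
    then have "x i = x i'" using less[of i i'] less[of i' i] by (metis less_irrefl linorder_cases)
    with * inj show "i = i'" by (meson inj_onD)
  qed
  moreover have "\<rho> ` {1..r} \<subseteq> {1..r}"
  proof safe
    fix i assume i: "i \<in> {1..r}"
    have "D i \<subseteq> {1..r}" by (auto simp: D_def)
    then have "card (D i) \<le> r" using card_mono[of "{1..r}" "D i"] by simp
    moreover have "i \<in> D i" using i by (simp add: D_def)
    then have "card (D i) > 0" using fin card_gt_0_iff by blast
    ultimately show "\<rho> i \<in> {1..r}" using i by (simp add: \<rho>_def)
  qed
  ultimately have "bij_betw \<rho> {1..r} {1..r}"
    by (simp add: bij_betw_def endo_inj_surj)
  then have "\<rho> permutes {1..r}"
    by (rule bij_imp_permutes) (simp only: \<rho>_def if_False)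
  with iff show ?thesis by blast
qed

lemma follows_total:
  assumes "k > 0" "\<And>a. a < k \<Longrightarrow> w a = {\<rho>. \<rho> permutes {1..r}}" and "distinct s"
  shows "follows r k w s"
  unfolding follows_def
proof (intro allI impI)
  fix j assume j: "j + r \<le> length s"
  have inj: "inj_on (\<lambda>i. s ! (j + i - 1)) {1..r}"
    using j \<open>distinct s\<close> by (auto simp: inj_on_def nth_eq_iff_index_eq)
  have "w (j mod k) = {\<rho>. \<rho> permutes {1..r}}" using assms by simp
  with inj ex_standardization[OF inj]
  show "inj_on (\<lambda>i. s ! (j + i - 1)) {1..r} \<and>
        (\<exists>\<rho> \<in> w (j mod k). \<forall>i\<in>{1..r}. \<forall>i'\<in>{1..r}.
            \<rho> i < \<rho> i' \<longleftrightarrow> s ! (j + i - 1) < s ! (j + i' - 1))" by auto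
qed

lemma follows_Nil: "is_pattern r k w \<Longrightarrow> follows r k w []"
  by (auto simp: follows_def is_pattern_def)

lemma longest_following_set:
  fixes n r k w \<sigma>
  defines "A \<equiv> {m. \<exists>\<tau>. \<tau> ` {1..m} \<subseteq> {1..n} \<and> strict_mono_on {1..m} \<tau> \<and>
            follows r k w (map (\<lambda>i. real (\<sigma> (\<tau> i))) [1..<Suc m])}"
  assumes "is_pattern r k w"
  shows "A \<subseteq> {..n}" "finite A" "0 \<in> A" "longest_following r k w n \<sigma> \<in> A"
proof -
  show 1: "A \<subseteq> {..n}"
  proof
    fix m assume "m \<in> A"
    then obtain \<tau> :: "nat \<Rightarrow> nat" where "\<tau> ` {1..m} \<subseteq> {1..n}" "strict_mono_on {1..m} \<tau>"
      by (auto simp: A_def)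
    then have "card {1..m} \<le> card {1..n}"
      by (meson card_inj_on_le finite_atLeastAtMost strict_mono_on_imp_inj_on)
    then show "m \<in> {..n}" by simp
  qed
  then show 2: "finite A" using finite_subset by blast
  show 3: "0 \<in> A" using follows_Nil[OF assms(2)] by (auto simp: A_def strict_mono_on_def)
  have "longest_following r k w n \<sigma> = Max A" by (simp add: longest_following_def A_def)
  then show "longest_following r k w n \<sigma> \<in> A" using 2 3 Max_in by auto
qed

lemma clt_imp_nondegenerate:
  assumes pat: "is_pattern r k w"
    and clt: "satisfies_clt uniform_perm (\<lambda>n \<sigma>. real (longest_following r k w n \<sigma>))"
  shows "nondegenerate r k w"
proof (rule ccontr)
  assume "\<not> nondegenerate r k w"
  then consider N where "\<And>s. follows r k w s \<Longrightarrow> length s < N"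
    | "\<And>a. a < k \<Longrightarrow> w a = {\<rho>. \<rho> permutes {1..r}}"
    by (auto simp: nondegenerate_def) (meson not_less)
  then show False
  proof cases
    case 1
    have "\<bar>real (longest_following r k w n \<sigma>) - 0 * real n\<bar> \<le> real N" for n \<sigma>
      using longest_following_set(4)[OF pat, where \<sigma> = \<sigma> and n = n] by (auto dest!: 1 simp del: upt_Suc)
    then have "\<not> satisfies_clt uniform_perm (\<lambda>n \<sigma>. real (longest_following r k w n \<sigma>))"
      by (rule not_clt_if_nearly_linear)
    with clt show False by blast
  next
    case 2
    have "\<bar>real (longest_following r k w n \<sigma>) - 1 * real n\<bar> \<le> 0" if "\<sigma> permutes {1..n}" for n \<sigma>
    proof -
      have "inj \<sigma>" using that by (rule permutes_inj)
      then have "distinct (map (\<lambda>i. real (\<sigma> i)) [1..<Suc n])"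
        by (auto simp: distinct_map inj_on_def)
      then have fol: "follows r k w (map (\<lambda>i. real (\<sigma> i)) [1..<Suc n])"
        using 2 pat by (intro follows_total) (auto simp: is_pattern_def)
      have "n \<le> longest_following r k w n \<sigma>"
        unfolding longest_following_def
        by (rule Max_ge[OF longest_following_set(2)[OF pat]])
           (use fol in \<open>auto intro!: exI[of _ "\<lambda>i. i"] simp: strict_mono_on_def simp del: upt_Suc\<close>)
      moreover have "longest_following r k w n \<sigma> \<le> n"
        using longest_following_set(1,4)[OF pat, where \<sigma> = \<sigma> and n = n] by blast
      ultimately show ?thesis by simp
    qed
    then have "\<not> satisfies_clt uniform_perm (\<lambda>n \<sigma>. real (longest_following r k w n \<sigma>))"
      by (rule not_clt_if_nearly_linear)
    with clt show False by blast
  qed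
qed

lemma degenerate_example_total:
  "is_pattern 1 1 (\<lambda>_. {id})" "combinatorial 1 1 (\<lambda>_. {id})" "\<not> nondegenerate 1 1 (\<lambda>_. {id})"
proof -
  have perm: "{\<rho>::nat \<Rightarrow> nat. \<rho> permutes {1..1}} = {id}" by auto
  show "is_pattern 1 1 (\<lambda>_. {id})" by (auto simp: is_pattern_def permutes_id)
  show "combinatorial 1 1 (\<lambda>_. {id})"
    unfolding combinatorial_def by (auto simp: follows_def intro!: exI[of _ "_ @ _"])
  show "\<not> nondegenerate 1 1 (\<lambda>_. {id})" using perm by (auto simp: nondegenerate_def)
qed

lemma degenerate_example_bounded:
  defines "w \<equiv> \<lambda>_. {Transposition.transpose 2 (3::nat)}"
  shows "is_pattern 3 6 w" "combinatorial 3 6 w" "\<not> nondegenerate 3 6 w"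
proof -
  have len: "length s \<le> 3" if "follows 3 6 w s" for s
  proof (rule ccontr)
    assume "\<not> length s \<le> 3"
    then have "0 + 3 \<le> length s" "1 + 3 \<le> length s" by auto
    from that[unfolded follows_def, rule_format, OF this(1)]
         that[unfolded follows_def, rule_format, OF this(2)]
    have "(\<forall>i\<in>{1..3}. \<forall>i'\<in>{1..3}. Transposition.transpose 2 3 i < Transposition.transpose 2 3 i' \<longleftrightarrow> s ! (i - 1) < s ! (i' - 1))"
      and "(\<forall>i\<in>{1..3}. \<forall>i'\<in>{1..3}. Transposition.transpose 2 3 i < Transposition.transpose 2 3 i' \<longleftrightarrow> s ! i < s ! i')"
      by (auto simp: w_def)
    from this(1)[THEN bspec, of 3, THEN bspec, of 2] this(2)[THEN bspec, of 1, THEN bspec, of 2]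
    show False by (simp add: transpose_def)
  qed
  show pat: "is_pattern 3 6 w" by (auto simp: is_pattern_def w_def intro!: permutes_swap_id)
  show "combinatorial 3 6 w"
    unfolding combinatorial_def
  proof (intro allI impI)
    fix s t assume "follows 3 6 w s" "follows 3 6 w t"
    with len[of s] len[of t] follows_Nil[OF pat]
    show "\<exists>u. subseq u (s @ t) \<and> follows 3 6 w u \<and> length s + length t \<le> length u + 6"
      by (intro exI[of _ "[]"]) auto
  qed
  show "\<not> nondegenerate 3 6 w"
    unfolding nondegenerate_def using len by (metis Suc_n_not_le_n le_trans)
qed

end

theory Submission
  imports Defs
begin

text \<open>
  Write \<open>L\<^sub>n\<close> for the length of the longest subsequence that follows \<open>w\<close>. The combinatorial property
  bounds \<open>L\<close> of a concatenation from below, and deleting fewer than \<open>k\<close> letters to correct the phase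
  bounds it from above, so \<open>L\<close> of a concatenation is the sum of the \<open>L\<close> of the parts up to an error
  \<open>k\<close>. As the relative orders of the two parts of a uniform permutation are independent and uniform,
  \<open>L\<^sub>n\<^sub>+\<^sub>m\<close> is, up to a bounded error, a sum of independent copies of \<open>L\<^sub>n\<close> and \<open>L\<^sub>m\<close>. Hence mean and
  variance are asymptotically linear and fourth central moments are \<open>O(n\<^sup>2)\<close>, and characteristic
  functions of about \<open>n\<^sup>1\<^sup>/\<^sup>3\<close> blocks multiply up to an error that vanishes after normalisation by
  \<open>sqrt n\<close>; Levy's continuity theorem gives the limit. Nondegeneracy yields two orders of a block
  whose \<open>L\<close> differ by more than \<open>4 k\<close>; exchanging them in the blocks of a long permutation shows that
  the variance grows linearly.
\<close>

section \<open>Longest following subsequences of a sequence\<close>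

text \<open>Each cut costs an error of up to \<open>k\<close>, so with blocks of bounded length the
  errors would add up to order \<open>n\<close>, and the classical theorem for independent summands
  gives nothing. The blocks must therefore grow. With \<open>N\<close> blocks the accumulated error
  is of order \<open>N\<close>, which is negligible against \<open>sqrt n\<close> only if
  \<open>N\<close> is much smaller than that, while \<open>N\<close> must tend to infinity for the
  Gaussian factor to emerge; the exponent 1/3 is one choice between 0 and 1/2. Fourth moments are
  there for the Taylor remainder of the characteristic function, where together with the variance
  they control the third absolute moment. Almost additivity alone gives a variance
  \<open>v * n\<close> up to an error of order \<open>sqrt n\<close> and leaves \<open>v = 0\<close>
  possible, which is what happens for degenerate combinatorial patterns. Positivity of
  \<open>v\<close> therefore needs a separate combinatorial argument.\<close>

abbreviation word :: "(nat \<Rightarrow> nat) \<Rightarrow> nat \<Rightarrow> real list" where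
  "word x n \<equiv> map (\<lambda>i. real (x i)) [1..<Suc n]"

lemma word_add: "word x (n + m) = word x n @ word (\<lambda>i. x (n + i)) m"
  by (induction m) auto

lemma inj_on_cong2:
  assumes "\<And>i j. i \<in> A \<Longrightarrow> j \<in> A \<Longrightarrow> f i = f j \<longleftrightarrow> g i = g j"
  shows "inj_on f A \<longleftrightarrow> inj_on g A"
  using assms unfolding inj_on_def by blast

lemma window_cong:
  assumes "\<And>i. i \<in> A \<Longrightarrow> f i = g i"
  shows "(inj_on f A \<and> (\<exists>\<rho>\<in>W. \<forall>i\<in>A. \<forall>i'\<in>A. (\<rho> i :: nat) < \<rho> i' \<longleftrightarrow> f i < f i')) \<longleftrightarrow>
    (inj_on g A \<and> (\<exists>\<rho>\<in>W. \<forall>i\<in>A. \<forall>i'\<in>A. \<rho> i < \<rho> i' \<longleftrightarrow> g i < g i'))"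
  by (intro conj_cong bex_cong ball_cong refl inj_on_cong) (simp_all add: assms)

text \<open>Patterns see a sequence only through comparisons of its entries; a tie is the failure of
  both strict comparisons.\<close>

lemma follows_cong:
  assumes len: "length s = length t"
    and ord: "\<And>i j. i < length s \<Longrightarrow> j < length s \<Longrightarrow> s ! i < s ! j \<longleftrightarrow> t ! i < t ! j"
  shows "follows r k w s \<longleftrightarrow> follows r k w t"
proof -
  have eq: "s ! i = s ! j \<longleftrightarrow> t ! i = t ! j" if "i < length s" "j < length s" for i j
    using ord[OF that] ord[OF that(2,1)] by (metis less_irrefl linorder_neqE)
  have bnd: "j + i - 1 < length s" if "j + r \<le> length s" "i \<in> {1..r}" for i j
    using that by auto
  have 1: "inj_on (\<lambda>i. s ! (j + i - 1)) {1..r} \<longleftrightarrow> inj_on (\<lambda>i. t ! (j + i - 1)) {1..r}"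
    if "j + r \<le> length s" for j
    by (intro inj_on_cong2 eq bnd[OF that])
  have 2: "(\<forall>i\<in>{1..r}. \<forall>i'\<in>{1..r}. \<rho> i < \<rho> i' \<longleftrightarrow> s ! (j + i - 1) < s ! (j + i' - 1)) \<longleftrightarrow>
      (\<forall>i\<in>{1..r}. \<forall>i'\<in>{1..r}. \<rho> i < \<rho> i' \<longleftrightarrow> t ! (j + i - 1) < t ! (j + i' - 1))"
    if "j + r \<le> length s" for j and \<rho> :: "nat \<Rightarrow> nat"
    by (intro ball_cong refl arg_cong2[of _ _ _ _ "(=)"] ord bnd[OF that])
  show ?thesis unfolding follows_def len[symmetric]
    by (intro all_cong conj_cong bex_cong refl 1 2)
qed

lemma follows_take: "follows r k w s \<Longrightarrow> follows r k w (take n s)"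
proof -
  assume f: "follows r k w s"
  have nth: "take n s ! (j + i - 1) = s ! (j + i - 1)" 
    if "j + r \<le> length (take n s)" "i \<in> {1..r}" for i j
    using that by auto
  show ?thesis unfolding follows_def
  proof (intro allI impI)
    fix j assume j: "j + r \<le> length (take n s)"
    then have "j + r \<le> length s" by simp
    from f[unfolded follows_def, rule_format, OF this]
    show "inj_on (\<lambda>i. take n s ! (j + i - 1)) {1..r} \<and>
        (\<exists>\<rho> \<in> w (j mod k). \<forall>i\<in>{1..r}. \<forall>i'\<in>{1..r}.
            \<rho> i < \<rho> i' \<longleftrightarrow> take n s ! (j + i - 1) < take n s ! (j + i' - 1))"
      using window_cong[of "{1..r}" "\<lambda>i. take n s ! (j + i - 1)" "\<lambda>i. s ! (j + i - 1)", OF nth[OF j]]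
      by blast
  qed
qed

text \<open>Deleting \<open>q\<close> letters at the front advances the phase by \<open>q\<close>.
  Writing the phase as an offset in the argument of \<open>w\<close> lets the same predicate cover
  all rotations of the pattern.\<close>

lemma follows_drop:
  assumes f: "follows r k (\<lambda>j. w ((c + j) mod k)) s" and q: "q \<le> length s"
  shows "follows r k (\<lambda>j. w ((c + q + j) mod k)) (drop q s)"
  unfolding follows_def
proof (intro allI impI)
  fix j assume j: "j + r \<le> length (drop q s)"
  then have "(q + j) + r \<le> length s" using q by simp
  from f[unfolded follows_def, rule_format, OF this]
  have *: "inj_on (\<lambda>i. s ! (q + j + i - 1)) {1..r}"
    "\<exists>\<rho> \<in> w ((c + (q + j) mod k) mod k). \<forall>i\<in>{1..r}. \<forall>i'\<in>{1..r}.
            \<rho> i < \<rho> i' \<longleftrightarrow> s ! (q + j + i - 1) < s ! (q + j + i' - 1)" by auto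
  have nth: "drop q s ! (j + i - 1) = s ! (q + j + i - 1)" if "i \<in> {1..r}" for i
    using that q by (subst nth_drop) (auto simp: algebra_simps)
  have "(c + (q + j) mod k) mod k = (c + q + j mod k) mod k"
    by (metis add.assoc mod_add_right_eq)
  with * show "inj_on (\<lambda>i. drop q s ! (j + i - 1)) {1..r} \<and>
        (\<exists>\<rho> \<in> w ((c + q + j mod k) mod k). \<forall>i\<in>{1..r}. \<forall>i'\<in>{1..r}.
            \<rho> i < \<rho> i' \<longleftrightarrow> drop q s ! (j + i - 1) < drop q s ! (j + i' - 1))"
    using window_cong[of "{1..r}" "\<lambda>i. drop q s ! (j + i - 1)" "\<lambda>i. s ! (q + j + i - 1)", OF nth]
    by auto
qed

lemma follows_mod_eq: "follows r k (\<lambda>j. w ((c + j) mod k)) s \<longleftrightarrow> follows r k w s" if "k dvd c"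
proof -
  have "(c + j mod k) mod k = j mod k" for j using that by (auto elim!: dvdE simp: mod_simps)
  then show ?thesis by (simp add: follows_def)
qed

lemma subseq_word_iff:
  "subseq u (word x n) \<longleftrightarrow> (\<exists>\<tau>. \<tau> ` {1..length u} \<subseteq> {1..n} \<and> strict_mono_on {1..length u} \<tau> \<and>
      u = word (\<lambda>i. x (\<tau> i)) (length u))" (is "?l \<longleftrightarrow> ?r")
proof
  assume ?l
  then obtain N where u: "u = nths (word x n) N" by (auto simp: subseq_conv_nths)
  define ps where "ps = nths [1..<Suc n] N"
  have ui: "u = map (\<lambda>i. real (x i)) ps" unfolding u ps_def nths_map ..
  have set: "set ps \<subseteq> {1..n}" unfolding ps_def using set_nths_subset[of "[1..<Suc n]" N] by auto
  have sorted: "sorted ps" "distinct ps" by (auto simp: ps_def simp del: upt_Suc intro: sorted_nths)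
  have len: "length ps = length u" by (simp add: ui)
  \<comment> \<open>\<open>ps\<close> lists the chosen positions from index 0, whereas the embedding
    is indexed from 1.\<close>
  show ?r
  proof (intro exI[of _ "\<lambda>i. ps ! (i - 1)"] conjI)
    show "(\<lambda>i. ps ! (i - 1)) ` {1..length u} \<subseteq> {1..n}"
      using set len by (force simp: image_subset_iff)
    have "sorted_wrt (<) ps" using sorted by (intro strict_sorted_iff[THEN iffD2] conjI)
    then show "strict_mono_on {1..length u} (\<lambda>i. ps ! (i - 1))"
      using len by (auto simp: strict_mono_on_def sorted_wrt_iff_nth_less)
    show "u = word (\<lambda>i. x (ps ! (i - 1))) (length u)"
      by (rule nth_equalityI) (auto simp: ui simp del: upt_Suc)
  qed
next
  assume ?r
  then obtain \<tau> where t: "\<tau> ` {1..length u} \<subseteq> {1..n}" "strict_mono_on {1..length u} \<tau>"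
    and u: "u = word (\<lambda>i. x (\<tau> i)) (length u)" by blast
  have "sorted_wrt (<) (map \<tau> [1..<Suc (length u)])"
    using t(2) by (auto simp: sorted_wrt_iff_nth_less strict_mono_on_def simp del: upt_Suc)
  then have "subseq (map \<tau> [1..<Suc (length u)]) [1..<Suc n]"
    using t(1) by (intro sorted_subset_imp_subseq)
      (auto simp: strict_sorted_iff image_subset_iff less_Suc_eq_le simp del: upt_Suc)
  from subseq_map[OF this, of "\<lambda>i. real (x i)"] show ?l
    by (subst u) (simp add: o_def del: upt_Suc)
qed

text \<open>Replacing index maps by sublists makes prefixes, suffixes and concatenation
  available.\<close>

lemma longest_following_eq:
  "longest_following r k w n x = Max {length u |u. subseq u (word x n) \<and> follows r k w u}"
proof -
  have "(\<exists>\<tau>. \<tau> ` {1..m} \<subseteq> {1..n} \<and> strict_mono_on {1..m} \<tau> \<and>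
          follows r k w (map (\<lambda>i. real (x (\<tau> i))) [1..<Suc m])) \<longleftrightarrow>
        (\<exists>u. m = length u \<and> subseq u (word x n) \<and> follows r k w u)" (is "?l \<longleftrightarrow> ?r") for m
  proof
    assume ?l
    then obtain \<tau> where t: "\<tau> ` {1..m} \<subseteq> {1..n}" "strict_mono_on {1..m} \<tau>"
      "follows r k w (word (\<lambda>i. x (\<tau> i)) m)" by blast
    then have "subseq (word (\<lambda>i. x (\<tau> i)) m) (word x n)"
      by (subst subseq_word_iff) (auto simp del: upt_Suc)
    with t show ?r by (intro exI[of _ "word (\<lambda>i. x (\<tau> i)) m"]) (auto simp del: upt_Suc)
  next
    assume ?r
    then obtain u where u: "m = length u" "subseq u (word x n)" "follows r k w u" by blast
    then obtain \<tau> where t: "\<tau> ` {1..m} \<subseteq> {1..n}" "strict_mono_on {1..m} \<tau>"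
      "u = word (\<lambda>i. x (\<tau> i)) m" using subseq_word_iff[THEN iffD1, OF u(2)] unfolding u(1) by blast
    have "follows r k w (word (\<lambda>i. x (\<tau> i)) m)" using u(3) t(3) by (rule subst[rotated])
    with t(1,2) show ?l by blast
  qed
  then show ?thesis unfolding longest_following_def by (intro arg_cong[of _ _ Max] Collect_cong)
qed

text \<open>Arbitrary functions are allowed because the later part of a permutation, read as
  \<open>\<lambda>i. \<sigma> (n + i)\<close>, need not permute an initial segment.\<close>

lemma longest_following_cong:
  assumes "\<And>i j. i \<in> {1..n} \<Longrightarrow> j \<in> {1..n} \<Longrightarrow> x i < x j \<longleftrightarrow> y i < y j"
  shows "longest_following r k w n x = longest_following r k w n y"
proof -
  have "follows r k w (word (\<lambda>i. x (\<tau> i)) m) \<longleftrightarrow> follows r k w (word (\<lambda>i. y (\<tau> i)) m)"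
    if "\<tau> ` {1..m} \<subseteq> {1..n}" for \<tau> m
    by (rule follows_cong) (use that assms in \<open>auto simp: image_subset_iff simp del: upt_Suc\<close>)
  then show ?thesis unfolding longest_following_def
    by (intro arg_cong[of _ _ Max] Collect_cong ex_cong1 conj_cong refl) auto
qed

lemma finite_subseq_lengths: "finite {length u |u. subseq u xs \<and> P u}"
  by (rule finite_subset[of _ "{..length xs}"]) (auto dest: list_emb_length)

lemma longest_following_ge:
  assumes "subseq u (word x n)" "follows r k w u"
  shows "length u \<le> longest_following r k w n x"
  unfolding longest_following_eq using assms by (intro Max_ge finite_subseq_lengths) auto

lemma longest_following_obtain:
  assumes "is_pattern r k w"
  obtains u where "subseq u (word x n)" "follows r k w u" "length u = longest_following r k w n x"
proof -
  have "longest_following r k w n x \<in> {length u |u. subseq u (word x n) \<and> follows r k w u}"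
    unfolding longest_following_eq
    by (rule Max_in[OF finite_subseq_lengths]) (use follows_Nil[OF assms] in auto)
  then show ?thesis using that by auto
qed

lemma longest_following_superadditive:
  assumes pat: "is_pattern r k w" and comb: "combinatorial r k w"
  shows "longest_following r k w n x + longest_following r k w m (\<lambda>i. x (n + i))
           \<le> longest_following r k w (n + m) x + k"
proof -
  obtain s where s: "subseq s (word x n)" "follows r k w s" "length s = longest_following r k w n x"
    using longest_following_obtain[OF pat] .
  obtain t where t: "subseq t (word (\<lambda>i. x (n + i)) m)" "follows r k w t"
      "length t = longest_following r k w m (\<lambda>i. x (n + i))"
    using longest_following_obtain[OF pat] .
  obtain u where u: "subseq u (s @ t)" "follows r k w u" "length s + length t \<le> length u + k"
    using comb s(2) t(2) unfolding combinatorial_def by blast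
  have "subseq u (word x (n + m))"
    unfolding word_add using u(1) s(1) t(1) by (meson list_emb_append_mono subseq_order.order_trans)
  from longest_following_ge[OF this u(2)] u(3) s(3) t(3) show ?thesis by linarith
qed

text \<open>The second part of a subsequence that follows \<open>w\<close> may start in the wrong phase; deleting
  fewer than \<open>k\<close> of its letters corrects this.\<close>

lemma longest_following_subadditive:
  assumes pat: "is_pattern r k w"
  shows "longest_following r k w (n + m) x
           \<le> longest_following r k w n x + longest_following r k w m (\<lambda>i. x (n + i)) + k"
proof -
  have k: "k > 0" using pat by (simp add: is_pattern_def)
  obtain u where u: "subseq u (word x (n + m))" "follows r k w u"
      "length u = longest_following r k w (n + m) x"
    using longest_following_obtain[OF pat] .
  obtain u1 u2 where uu: "u = u1 @ u2" "subseq u1 (word x n)" "subseq u2 (word (\<lambda>i. x (n + i)) m)"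
    using u(1) unfolding word_add by (elim subseq_appendE)
  have "follows r k w u1" using follows_take[OF u(2), of "length u1"] by (simp add: uu)
  then have 1: "length u1 \<le> longest_following r k w n x" by (rule longest_following_ge[OF uu(2)])
  \<comment> \<open>The least number of letters to skip after \<open>u1\<close> to reach an index
    divisible by \<open>k\<close>; the outer \<open>mod\<close> turns the value \<open>k\<close>
    into 0.\<close>
  define d where "d = (k - length u1 mod k) mod k"
  have d: "d < k" "k dvd length u1 + d"
  proof -
    show "d < k" using k by (simp add: d_def)
    have "length u1 mod k \<le> k" using k by (simp add: less_imp_le)
    then have "length u1 + (k - length u1 mod k) = k * (length u1 div k) + k"
      using mult_div_mod_eq[of k "length u1"] by linarith
    then have "(length u1 + d) mod k = 0" by (simp add: d_def mod_add_right_eq)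
    then show "k dvd length u1 + d" by (simp add: mod_eq_0_iff_dvd)
  qed
  show ?thesis
  proof (cases "length u2 \<le> d")
    case True
    then show ?thesis using 1 uu(1) u(3) d(1) by simp
  next
    case False
    have "follows r k (\<lambda>j. w ((0 + j) mod k)) u" using u(2) by (subst follows_mod_eq) auto
    from follows_drop[OF this, of "length u1 + d"]
    have "follows r k w (drop (length u1 + d) u)"
      using False uu(1) follows_mod_eq[OF d(2)] by simp
    moreover have "drop (length u1 + d) u = drop d u2" by (simp add: uu(1))
    moreover have "subseq (drop d u2) (word (\<lambda>i. x (n + i)) m)"
      using uu(3) by (meson subseq_order.order_trans suffix_drop suffix_imp_subseq)
    ultimately have "length (drop d u2) \<le> longest_following r k w m (\<lambda>i. x (n + i))"
      by (intro longest_following_ge) auto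
    then show ?thesis using 1 uu(1) u(3) d(1) False by simp
  qed
qed


section \<open>Two permutations of one length with very different
  \<open>longest_following\<close>\<close>

text \<open>A value is one more than the number of smaller values, so comparisons determine a
  permutation. Hence a window ordered like a forbidden permutation cannot be accepted through
  another one.\<close>

lemma permutes_eq_of_order_iso:
  assumes \<sigma>: "\<sigma> permutes {1..r}" and \<tau>: "\<tau> permutes {1..r::nat}"
    and ord: "\<And>i j. i \<in> {1..r} \<Longrightarrow> j \<in> {1..r} \<Longrightarrow> \<sigma> i < \<sigma> j \<longleftrightarrow> \<tau> i < \<tau> j"
  shows "\<sigma> = \<tau>"
proof
  have card: "card {l \<in> {1..r}. \<pi> l < \<pi> i} = \<pi> i - 1" if p: "\<pi> permutes {1..r}" and i: "i \<in> {1..r}" for \<pi> i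
  proof -
    have "\<pi> i \<in> {1..r}" using p i by (simp only: permutes_in_image)
    have "\<pi> ` {l \<in> {1..r}. \<pi> l < \<pi> i} = {1..<\<pi> i}"
    proof (intro equalityI subsetI)
      fix y assume "y \<in> {1..<\<pi> i}"
      then have "y \<in> {1..r}" "y < \<pi> i" using \<open>\<pi> i \<in> {1..r}\<close> by auto
      then show "y \<in> \<pi> ` {l \<in> {1..r}. \<pi> l < \<pi> i}"
        using permutes_image[OF p] by (smt (verit) image_iff mem_Collect_eq)
    qed (use permutes_in_image[OF p] in auto)
    then have "card {1..<\<pi> i} = card {l \<in> {1..r}. \<pi> l < \<pi> i}"
      using card_image[OF inj_on_subset[OF permutes_inj[OF p] subset_UNIV]] by metis
    then show ?thesis by simp
  qed
  fix i
  show "\<sigma> i = \<tau> i"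
  proof (cases "i \<in> {1..r}")
    case True
    then have "{l \<in> {1..r}. \<sigma> l < \<sigma> i} = {l \<in> {1..r}. \<tau> l < \<tau> i}" using ord by blast
    then have "\<sigma> i - 1 = \<tau> i - 1" using card[OF \<sigma> True] card[OF \<tau> True] by simp
    moreover have "\<sigma> i \<in> {1..r}" "\<tau> i \<in> {1..r}"
      using True \<sigma> \<tau> by (simp_all only: permutes_in_image)
    ultimately show ?thesis by auto
  next
    case False
    then show ?thesis using permutes_not_in[OF \<sigma>] permutes_not_in[OF \<tau>] by simp
  qed
qed

text \<open>The word below is a direct sum of copies of \<open>\<rho>\<close> with a single forbidden \<open>\<rho>\<close>. As the blocks have
  length \<open>r k + 1\<close>, which is 1 modulo \<open>k\<close>, every stretch of \<open>k\<close> blocks meets the forbidden window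
  in each phase, so that one letter of each such stretch has to be deleted.\<close>

lemma longest_following_direct_sum:
  fixes r k a M :: nat and \<rho> :: "nat \<Rightarrow> nat"
  defines "l \<equiv> r * k + 1"
  defines "x \<equiv> \<lambda>p. ((p - 1) div l) * l + \<rho> ((p - 1) mod l + 1)"
  assumes pat: "is_pattern r k w" and a: "a < k" and \<rho>: "\<rho> permutes {1..r}" "\<rho> \<notin> w a"
  shows "inj_on x {1..}" "longest_following r k w (M * (k * l)) x + M \<le> M * (k * l)"
proof -
  have l: "l > 0" "r \<le> l" using a by (auto simp: l_def intro: le_SucI)
  \<comment> \<open>\<open>\<rho>\<close> fixes the letters from \<open>r + 1\<close> to
    \<open>l\<close>, so each block is \<open>\<rho>\<close> followed by an increasing tail that
    pads its length to 1 modulo \<open>k\<close>.\<close>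
  have \<rho>l: "\<rho> permutes {1..l}" using \<rho>(1) by (rule permutes_subset) (use l in auto)
  show "inj_on x {1..}"
  proof (rule inj_onI)
    fix p q assume pq: "p \<in> {1..}" "q \<in> {1..}" "x p = x q"
    have range: "\<rho> (m mod l + 1) - 1 < l" "\<rho> (m mod l + 1) \<ge> 1" for m
    proof -
      have "m mod l + 1 \<in> {1..l}" using l by (simp add: Suc_leI)
      then have "\<rho> (m mod l + 1) \<in> {1..l}" by (simp only: permutes_in_image[OF \<rho>l])
      then show "\<rho> (m mod l + 1) - 1 < l" "\<rho> (m mod l + 1) \<ge> 1" using l by auto
    qed
    have x1: "x p - 1 = ((p - 1) div l) * l + (\<rho> ((p - 1) mod l + 1) - 1)" for p
      using range(2)[of "p - 1"] by (simp add: x_def)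
    have "(x p - 1) div l = (p - 1) div l" "(x p - 1) mod l = \<rho> ((p - 1) mod l + 1) - 1" for p
      unfolding x1 using range(1)[of "p - 1"] l by auto
    then have d: "(p - 1) div l = (q - 1) div l"
      and "\<rho> ((p - 1) mod l + 1) - 1 = \<rho> ((q - 1) mod l + 1) - 1"
      using pq(3) by metis+
    then have "\<rho> ((p - 1) mod l + 1) = \<rho> ((q - 1) mod l + 1)"
      using range(2)[of "p - 1"] range(2)[of "q - 1"] by linarith
    then have "(p - 1) mod l = (q - 1) mod l"
      using permutes_inj[OF \<rho>l] by (simp add: inj_eq)
    with d have "p - 1 = q - 1" by (metis mod_div_mult_eq)
    then show "p = q" using pq by auto
  qed
  \<comment> \<open>Every starting phase \<open>c\<close> has to be excluded, because letters
    deleted from earlier stretches shift the phase of this one.\<close>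
  have bad: "\<not> follows r k (\<lambda>j. w ((c + j) mod k)) (word (\<lambda>i. x (N * (k * l) + i)) (k * l))" for c N
  proof
    assume f: "follows r k (\<lambda>j. w ((c + j) mod k)) (word (\<lambda>i. x (N * (k * l) + i)) (k * l))"
    \<comment> \<open>Modulo \<open>k\<close> this is \<open>a - c\<close>, written without
      truncated subtraction. Block \<open>q\<close> starts at index \<open>q * l\<close>, which is
      \<open>q\<close> modulo \<open>k\<close>, hence in phase \<open>a\<close>.\<close>
    define q where "q = (a + (k - c mod k)) mod k"
    have q: "q < k" using a by (simp add: q_def)
    have "q * l = q + k * (q * r)" by (simp add: l_def algebra_simps)
    then have "(c + (q * l) mod k) mod k = (c + q) mod k" by (simp add: mod_simps)
    also have "\<dots> = (c mod k + (a + (k - c mod k))) mod k" by (simp add: q_def mod_simps)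
    also have "c mod k + (a + (k - c mod k)) = a + k"
      using a mod_less_divisor[of k c] by linarith
    finally have phase: "(c + (q * l) mod k) mod k = a" using a by simp
    have "q * l + l \<le> k * l" using q by (metis Suc_leI add.commute mult_Suc mult_le_mono1)
    then have j: "q * l + r \<le> k * l" using l by linarith
    then have "q * l + r \<le> length (word (\<lambda>i. x (N * (k * l) + i)) (k * l))" by (simp del: upt_Suc)
    from f[unfolded follows_def, rule_format, OF this] obtain \<rho>' where \<rho>': "\<rho>' \<in> w a"
      and ord: "\<And>i i'. i \<in> {1..r} \<Longrightarrow> i' \<in> {1..r} \<Longrightarrow> \<rho>' i < \<rho>' i' \<longleftrightarrow>
         word (\<lambda>i. x (N * (k * l) + i)) (k * l) ! (q * l + i - 1)
           < word (\<lambda>i. x (N * (k * l) + i)) (k * l) ! (q * l + i' - 1)"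
      unfolding phase by blast
    have val: "word (\<lambda>i. x (N * (k * l) + i)) (k * l) ! (q * l + i - 1) = real ((N * k + q) * l + \<rho> i)"
      if i: "i \<in> {1..r}" for i
    proof -
      have b: "q * l + i - 1 < k * l" using i j by auto
      have s: "1 + (q * l + i - 1) = q * l + i" using i by auto
      have "N * (k * l) + (q * l + i) - 1 = (N * k + q) * l + (i - 1)"
        using i by (simp add: algebra_simps)
      moreover have il: "i - 1 < l" using i l by auto
      moreover have aux: "(A * l + b) div l = A" "(A * l + b) mod l = b" if "b < l" for A b
        using that by simp_all
      have "((N * k + q) * l + (i - 1)) div l = N * k + q" "((N * k + q) * l + (i - 1)) mod l = i - 1"
        by (rule aux[OF il])+
      ultimately have "x (N * (k * l) + (q * l + i)) = (N * k + q) * l + \<rho> (i - 1 + 1)"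
        by (simp add: x_def)
      then show ?thesis using b s i by (subst nth_map) (auto simp del: upt_Suc)
    qed
    have "\<rho>' permutes {1..r}" using \<rho>' pat a by (auto simp: is_pattern_def)
    then have "\<rho>' = \<rho>" using \<rho>(1) by (rule permutes_eq_of_order_iso) (simp add: ord val del: One_nat_def upt_Suc)
    with \<rho>' \<rho>(2) show False by simp
  qed
  have "length u + M \<le> M * (k * l)"
    if "subseq u (word x (M * (k * l)))" "follows r k (\<lambda>j. w ((0 + j) mod k)) u" for u
    using that
  proof (induction M arbitrary: u)
    case (Suc M)
    have eq: "Suc M * (k * l) = M * (k * l) + k * l" by simp
    obtain u1 u2 where uu: "u = u1 @ u2" "subseq u1 (word x (M * (k * l)))"
        "subseq u2 (word (\<lambda>i. x (M * (k * l) + i)) (k * l))"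
      using Suc.prems(1) unfolding eq word_add by (elim subseq_appendE)
    have "follows r k (\<lambda>j. w ((0 + j) mod k)) u1"
      using follows_take[OF Suc.prems(2), of "length u1"] by (simp add: uu)
    then have 1: "length u1 + M \<le> M * (k * l)" by (rule Suc.IH[OF uu(2)])
    have "follows r k (\<lambda>j. w ((length u1 + j) mod k)) u2"
      using follows_drop[OF Suc.prems(2), of "length u1"] by (simp add: uu)
    \<comment> \<open>By \<open>bad\<close> the last stretch cannot be kept in full, whatever phase
      \<open>u1\<close> leaves behind.\<close>
    then have "u2 \<noteq> word (\<lambda>i. x (M * (k * l) + i)) (k * l)" using bad by blast
    then have "length u2 \<noteq> k * l"
      using subseq_same_length[OF uu(3)] by (auto simp del: upt_Suc)
    moreover have "length u2 \<le> k * l" using list_emb_length[OF uu(3)] by (simp del: upt_Suc)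
    ultimately show ?case using 1 by (simp add: uu(1))
  qed simp
  moreover obtain u where "subseq u (word x (M * (k * l)))" "follows r k w u"
      "length u = longest_following r k w (M * (k * l)) x"
    using longest_following_obtain[OF pat] .
  ultimately show "longest_following r k w (M * (k * l)) x + M \<le> M * (k * l)"
    using follows_mod_eq[of k 0 r w] by (metis dvd_0_right)
qed

lemma longest_following_standardization:
  fixes x :: "nat \<Rightarrow> nat"
  assumes "inj_on x {1..n}"
  obtains \<rho> where "\<rho> permutes {1..n}"
    "\<And>i j. i \<in> {1..n} \<Longrightarrow> j \<in> {1..n} \<Longrightarrow> \<rho> i < \<rho> j \<longleftrightarrow> x i < x j"
proof -
  have "inj_on (\<lambda>i. real (x i)) {1..n}" using assms unfolding inj_on_def of_nat_eq_iff .
  from ex_standardization[OF this] obtain \<rho> where \<rho>: "\<rho> permutes {1..n}"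
    "\<forall>i\<in>{1..n}. \<forall>j\<in>{1..n}. \<rho> i < \<rho> j \<longleftrightarrow> real (x i) < real (x j)" by (elim exE conjE)
  have "\<rho> i < \<rho> j \<longleftrightarrow> x i < x j" if "i \<in> {1..n}" "j \<in> {1..n}" for i j
    using \<rho>(2)[rule_format, OF that] by simp
  with \<rho>(1) show ?thesis by (rule that)
qed

text \<open>Entries within one window are distinct, so preserving strict inequalities there
  preserves all comparisons. This leaves \<open>t\<close> free to separate equal entries of
  \<open>s\<close> that no window compares.\<close>

lemma follows_order_refine:
  assumes f: "follows r k w s" and len: "length t = length s"
    and ord: "\<And>i j. i < length s \<Longrightarrow> j < length s \<Longrightarrow> s ! i < s ! j \<Longrightarrow> t ! i < t ! j"
  shows "follows r k w t"
  unfolding follows_def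
proof (intro allI impI)
  fix j assume j: "j + r \<le> length t"
  then have j': "j + r \<le> length s" by (simp add: len)
  have bnd: "j + i - 1 < length s" if "i \<in> {1..r}" for i using that j' by auto
  from f[unfolded follows_def, rule_format, OF j'] obtain \<rho>
    where inj: "inj_on (\<lambda>i. s ! (j + i - 1)) {1..r}" and \<rho>: "\<rho> \<in> w (j mod k)"
    and iff: "\<And>i i'. i \<in> {1..r} \<Longrightarrow> i' \<in> {1..r} \<Longrightarrow> \<rho> i < \<rho> i' \<longleftrightarrow> s ! (j + i - 1) < s ! (j + i' - 1)"
    by blast
  have st: "s ! (j + i - 1) < s ! (j + i' - 1) \<longleftrightarrow> t ! (j + i - 1) < t ! (j + i' - 1)"
    if i: "i \<in> {1..r}" "i' \<in> {1..r}" for i i'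
  proof (cases "i = i'")
    case False
    with inj_onD[OF inj _ i] have "s ! (j + i - 1) \<noteq> s ! (j + i' - 1)" by blast
    then show ?thesis
      using ord[OF bnd[OF i(1)] bnd[OF i(2)]] ord[OF bnd[OF i(2)] bnd[OF i(1)]] by linarith
  qed simp
  have "inj_on (\<lambda>i. t ! (j + i - 1)) {1..r}"
  proof (rule inj_onI)
    fix i i' assume i: "i \<in> {1..r}" "i' \<in> {1..r}" "t ! (j + i - 1) = t ! (j + i' - 1)"
    with st[OF i(1,2)] st[OF i(2,1)] have "s ! (j + i - 1) = s ! (j + i' - 1)" by simp
    then show "i = i'" using inj_onD[OF inj _ i(1,2)] by blast
  qed
  with \<rho> iff st show "inj_on (\<lambda>i. t ! (j + i - 1)) {1..r} \<and>
        (\<exists>\<rho> \<in> w (j mod k). \<forall>i\<in>{1..r}. \<forall>i'\<in>{1..r}.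
            \<rho> i < \<rho> i' \<longleftrightarrow> t ! (j + i - 1) < t ! (j + i' - 1))" by blast
qed

text \<open>A sequence that follows \<open>w\<close> may repeat values at distance at least \<open>r\<close>; ties are broken by
  position.\<close>

lemma ex_permutation_following:
  assumes "\<And>N. \<exists>s. length s \<ge> N \<and> follows r k w s"
  obtains v where "v permutes {1..n}" "longest_following r k w n v \<ge> n"
proof -
  obtain s' where s': "length s' \<ge> n" "follows r k w s'" using assms by blast
  define s where "s = take n s'"
  have s: "length s = n" "follows r k w s" using s' by (auto simp: s_def follows_take)
  \<comment> \<open>The positions up to \<open>i\<close> in the lexicographic order by value and
    position; the size of this set is the rank of \<open>i\<close>.\<close>
  define D where "D i = {l\<in>{1..n}. s ! (l - 1) < s ! (i - 1) \<or> (s ! (l - 1) = s ! (i - 1) \<and> l \<le> i)}" for i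
  have less: "card (D i) < card (D j)"
    if "i \<in> {1..n}" "j \<in> {1..n}" "s ! (i - 1) < s ! (j - 1) \<or> (s ! (i - 1) = s ! (j - 1) \<and> i < j)" for i j
  proof -
    have "D i \<subseteq> D j" "j \<in> D j" "j \<notin> D i" using that by (auto simp: D_def)
    moreover have "finite (D j)" by (simp add: D_def)
    ultimately show ?thesis by (intro psubset_card_mono) blast+
  qed
  have "inj_on (\<lambda>i. card (D i)) {1..n}"
    by (rule inj_onI) (metis less linorder_less_linear less_irrefl)
  then obtain \<rho> where \<rho>: "\<rho> permutes {1..n}"
    "\<And>i j. i \<in> {1..n} \<Longrightarrow> j \<in> {1..n} \<Longrightarrow> \<rho> i < \<rho> j \<longleftrightarrow> card (D i) < card (D j)"
    by (rule longest_following_standardization) blast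
  have "follows r k w (word \<rho> n)"
  proof (rule follows_order_refine[OF s(2)])
    fix i j assume ij: "i < length s" "j < length s" "s ! i < s ! j"
    then have "Suc i \<in> {1..n}" "Suc j \<in> {1..n}" using s by auto
    then have "\<rho> (Suc i) < \<rho> (Suc j)" using \<rho>(2) less ij by simp
    then show "word \<rho> n ! i < word \<rho> n ! j" using ij s by (simp del: upt_Suc)
  qed (simp add: s del: upt_Suc)
  from longest_following_ge[OF subseq_order.order_refl this]
  have "longest_following r k w n \<rho> \<ge> n" by (simp del: upt_Suc)
  with \<rho>(1) that show ?thesis by blast
qed

text \<open>Each half of nondegeneracy supplies one permutation: arbitrarily long following
  sequences give \<open>v\<close>, which is followed in full, and a forbidden order gives
  \<open>v'\<close>, the direct sum that must lose many letters.\<close>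

lemma ex_large_spread:
  assumes pat: "is_pattern r k w" and nondeg: "nondegenerate r k w"
  obtains n v v' where "n > 0" "v permutes {1..n}" "v' permutes {1..n}"
    "longest_following r k w n v' + D < longest_following r k w n v"
proof -
  obtain a \<rho> where a: "a < k" "\<rho> permutes {1..r}" "\<rho> \<notin> w a"
    using nondeg pat unfolding nondegenerate_def is_pattern_def by blast
  \<comment> \<open>\<open>Suc D\<close> stretches of \<open>k\<close> blocks lose a letter each, so
    the spread exceeds \<open>D\<close>.\<close>
  define n where "n = Suc D * (k * (r * k + 1))"
  obtain x where x: "inj_on x {1..}" "longest_following r k w n x + Suc D \<le> n"
    unfolding n_def
    using longest_following_direct_sum[OF pat a] by blast
  have "inj_on x {1..n}" using x(1) by (rule inj_on_subset) auto
  then obtain v' where v': "v' permutes {1..n}"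
    "\<And>i j. i \<in> {1..n} \<Longrightarrow> j \<in> {1..n} \<Longrightarrow> v' i < v' j \<longleftrightarrow> x i < x j"
    by (rule longest_following_standardization) blast
  have "longest_following r k w n v' = longest_following r k w n x"
    by (rule longest_following_cong) (rule v'(2))
  moreover obtain v where "v permutes {1..n}" "longest_following r k w n v \<ge> n"
    using ex_permutation_following nondeg unfolding nondegenerate_def by metis
  moreover have "n > 0" using a(1) by (simp add: n_def)
  ultimately show ?thesis using that[of n v v'] v'(1) x(2) by linarith
qed

section \<open>Blocks of a uniform random permutation\<close>

abbreviation perms :: "nat \<Rightarrow> (nat \<Rightarrow> nat) set" where
  "perms n \<equiv> {\<sigma>. \<sigma> permutes {1..n}}"

abbreviation uniform_perm_pmf :: "nat \<Rightarrow> (nat \<Rightarrow> nat) pmf" where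
  "uniform_perm_pmf n \<equiv> pmf_of_set (perms n)"

lemma perms_nonempty: "perms n \<noteq> {}"
  using permutes_id by blast

lemma finite_perms: "finite (perms n)"
  by (rule finite_permutations) simp

lemma set_uniform_perm_pmf: "set_pmf (uniform_perm_pmf n) = perms n"
  using perms_nonempty finite_perms by (rule set_pmf_of_set)

lemma bij_betw_perms_compose_right:
  assumes "g permutes {1..n}"
  shows "bij_betw (\<lambda>\<sigma>. \<sigma> \<circ> g) (perms n) (perms n)"
proof (rule bij_betw_byWitness[where f' = "\<lambda>\<sigma>. \<sigma> \<circ> inv g"])
  show "\<forall>\<sigma>\<in>perms n. (\<sigma> \<circ> g) \<circ> inv g = \<sigma>" "\<forall>\<sigma>\<in>perms n. (\<sigma> \<circ> inv g) \<circ> g = \<sigma>"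
    using permutes_inv_o[OF assms] by (auto simp: comp_assoc)
qed (use permutes_compose[OF assms] permutes_compose[OF permutes_inv[OF assms]] in auto)

lemma bij_betw_perms_compose_left:
  assumes "g permutes {1..n}"
  shows "bij_betw (\<lambda>\<sigma>. g \<circ> \<sigma>) (perms n) (perms n)"
proof (rule bij_betw_byWitness[where f' = "\<lambda>\<sigma>. inv g \<circ> \<sigma>"])
  show "\<forall>\<sigma>\<in>perms n. inv g \<circ> (g \<circ> \<sigma>) = \<sigma>" "\<forall>\<sigma>\<in>perms n. g \<circ> (inv g \<circ> \<sigma>) = \<sigma>"
    using permutes_inv_o[OF assms] by (auto simp: comp_assoc[symmetric])
qed (use permutes_compose[OF _ assms] permutes_compose[OF _ permutes_inv[OF assms]] in auto)

lemma map_uniform_perm_compose_right: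
  "g permutes {1..n} \<Longrightarrow> map_pmf (\<lambda>\<sigma>. \<sigma> \<circ> g) (uniform_perm_pmf n) = uniform_perm_pmf n"
  by (rule map_pmf_of_set_bij_betw[OF bij_betw_perms_compose_right perms_nonempty finite_perms])

lemma map_uniform_perm_compose_left:
  "g permutes {1..n} \<Longrightarrow> map_pmf (\<lambda>\<sigma>. g \<circ> \<sigma>) (uniform_perm_pmf n) = uniform_perm_pmf n"
  by (rule map_pmf_of_set_bij_betw[OF bij_betw_perms_compose_left perms_nonempty finite_perms])

text \<open>Composed on the right of \<open>\<sigma>\<close>, this rearranges positions within one
  block: the set of values in the block is kept, only their relative order changes.\<close>

definition block_perm :: "nat \<Rightarrow> nat \<Rightarrow> (nat \<Rightarrow> nat) \<Rightarrow> nat \<Rightarrow> nat" where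
  "block_perm b m g i = (if i \<in> {b + 1..b + m} then b + g (i - b) else i)"

lemma block_perm_in: "i \<in> {1..m} \<Longrightarrow> block_perm b m g (b + i) = b + g i"
  by (simp add: block_perm_def)

lemma block_perm_out: "i \<notin> {b + 1..b + m} \<Longrightarrow> block_perm b m g i = i"
  by (simp only: block_perm_def if_False)

lemma block_perm_permutes:
  assumes g: "g permutes {1..m}" and n: "b + m \<le> n"
  shows "block_perm b m g permutes {1..n}"
proof -
  have in_block: "block_perm b m h i - b = h (i - b)" "block_perm b m h i \<in> {b + 1..b + m}"
    if h: "h permutes {1..m}" and i: "i \<in> {b + 1..b + m}" for h i
  proof -
    have "i - b \<in> {1..m}" using i by auto
    then have "h (i - b) \<in> {1..m}" by (simp only: permutes_in_image[OF h])
    then show "block_perm b m h i - b = h (i - b)" "block_perm b m h i \<in> {b + 1..b + m}"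
      using i by (auto simp: block_perm_def)
  qed
  have inv: "block_perm b m h' (block_perm b m h i) = i"
    if h: "h permutes {1..m}" and h': "\<And>j. h' (h j) = j" and i: "i \<in> {b + 1..b + m}" for h h' i
    using in_block[OF h i] i h' unfolding block_perm_def[of b m h' "block_perm b m h i"] by simp
  have "bij_betw (block_perm b m g) {b + 1..b + m} {b + 1..b + m}"
  proof (rule bij_betw_byWitness[where f' = "block_perm b m (inv g)"])
    show "\<forall>i\<in>{b + 1..b + m}. block_perm b m (inv g) (block_perm b m g i) = i"
      using inv[OF g, of "inv g"] permutes_inverses(2)[OF g] by blast
    show "\<forall>i\<in>{b + 1..b + m}. block_perm b m g (block_perm b m (inv g) i) = i"
      using inv[OF permutes_inv[OF g], of g] permutes_inverses(1)[OF g] by blast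
  qed (use in_block(2)[OF g] in_block(2)[OF permutes_inv[OF g]] in blast)+
  then have "block_perm b m g permutes {b + 1..b + m}"
    by (rule bij_imp_permutes) (rule block_perm_out)
  then show ?thesis by (rule permutes_subset) (use n in auto)
qed

text \<open>If \<open>\<rho>\<close> is the standardization of \<open>x\<close>, then
  \<open>x\<close> after \<open>g\<close> is ordered like \<open>\<rho> \<circ> g\<close>, and left
  multiplication by \<open>\<rho>\<close> preserves the uniform law.\<close>

lemma longest_following_uniform:
  assumes "inj_on x {1..n}"
  shows "map_pmf (\<lambda>g. longest_following r k w n (\<lambda>i. x (g i))) (uniform_perm_pmf n)
    = map_pmf (longest_following r k w n) (uniform_perm_pmf n)"
proof -
  obtain \<rho> where \<rho>: "\<rho> permutes {1..n}"
    "\<And>i j. i \<in> {1..n} \<Longrightarrow> j \<in> {1..n} \<Longrightarrow> \<rho> i < \<rho> j \<longleftrightarrow> x i < x j"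
    by (rule longest_following_standardization[OF assms]) blast
  have "longest_following r k w n (\<lambda>i. x (g i)) = longest_following r k w n (\<rho> \<circ> g)"
    if g: "g permutes {1..n}" for g
  proof (rule longest_following_cong)
    fix i j assume "i \<in> {1..n}" "j \<in> {1..n}"
    then have "g i \<in> {1..n}" "g j \<in> {1..n}" by (simp_all only: permutes_in_image[OF g])
    then show "x (g i) < x (g j) \<longleftrightarrow> (\<rho> \<circ> g) i < (\<rho> \<circ> g) j" using \<rho>(2) by (simp only: o_apply)
  qed
  then have "map_pmf (\<lambda>g. longest_following r k w n (\<lambda>i. x (g i))) (uniform_perm_pmf n)
      = map_pmf (\<lambda>g. longest_following r k w n (\<rho> \<circ> g)) (uniform_perm_pmf n)"
    by (intro map_pmf_cong refl) (simp_all only: set_uniform_perm_pmf mem_Collect_eq)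
  also have "\<dots> = map_pmf (longest_following r k w n) (map_pmf (\<lambda>g. \<rho> \<circ> g) (uniform_perm_pmf n))"
    by (simp add: map_pmf_comp)
  finally show ?thesis by (simp only: map_uniform_perm_compose_left[OF \<rho>(1)])
qed

text \<open>Permuting the positions within the two blocks preserves the uniform distribution and makes the
  pair of relative orders uniform, whatever the values in the blocks are.\<close>

lemma longest_following_blocks_indep:
  "map_pmf (\<lambda>\<sigma>. (longest_following r k w n \<sigma>, longest_following r k w m (\<lambda>i. \<sigma> (n + i))))
      (uniform_perm_pmf (n + m))
    = pair_pmf (map_pmf (longest_following r k w n) (uniform_perm_pmf n))
        (map_pmf (longest_following r k w m) (uniform_perm_pmf m))"
    (is "map_pmf ?F ?U = ?R")
proof -
  define c where "c g h = block_perm 0 n g \<circ> block_perm n m h" for g h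
  have c: "c g h permutes {1..n + m}" if "g permutes {1..n}" "h permutes {1..m}" for g h
    unfolding c_def using that by (intro permutes_compose block_perm_permutes) auto
  have F: "?F (\<sigma> \<circ> c g h) =
      (longest_following r k w n (\<lambda>i. \<sigma> (g i)), longest_following r k w m (\<lambda>i. \<sigma> (n + h i)))"
    if "g permutes {1..n}" "h permutes {1..m}" for \<sigma> g h
  proof -
    have 1: "c g h i = g i" if "i \<in> {1..n}" for i
      using that block_perm_in[of i n 0 g] by (simp add: c_def block_perm_out)
    have 2: "c g h (n + i) = n + h i" if i: "i \<in> {1..m}" for i
    proof -
      have "h i \<in> {1..m}" using i by (simp only: permutes_in_image[OF \<open>h permutes {1..m}\<close>])
      then show ?thesis using block_perm_in[OF i, of n h] by (simp add: c_def block_perm_out)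
    qed
    show ?thesis
      by (intro prod_eqI) (auto intro!: longest_following_cong simp: 1 2 simp del: One_nat_def)
  qed
  \<comment> \<open>Reordering by fixed \<open>g\<close> and \<open>h\<close> preserves the law of
    \<open>\<sigma>\<close>, hence so does reordering by independent random ones.\<close>
  have "?U = bind_pmf (uniform_perm_pmf n) (\<lambda>g. bind_pmf (uniform_perm_pmf m) (\<lambda>h. ?U))"
    by simp
  also have "\<dots> = bind_pmf (uniform_perm_pmf n) (\<lambda>g. bind_pmf (uniform_perm_pmf m)
      (\<lambda>h. map_pmf (\<lambda>\<sigma>. \<sigma> \<circ> c g h) ?U))"
    by (intro bind_pmf_cong refl map_uniform_perm_compose_right[symmetric] c)
       (simp_all only: set_uniform_perm_pmf mem_Collect_eq)
  finally have eq: "?U = bind_pmf (uniform_perm_pmf n) (\<lambda>g. bind_pmf (uniform_perm_pmf m)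
      (\<lambda>h. map_pmf (\<lambda>\<sigma>. \<sigma> \<circ> c g h) ?U))" .
  have "map_pmf ?F ?U = bind_pmf (uniform_perm_pmf n) (\<lambda>g. bind_pmf (uniform_perm_pmf m)
      (\<lambda>h. map_pmf (\<lambda>\<sigma>. ?F (\<sigma> \<circ> c g h)) ?U))"
    using arg_cong[OF eq, of "map_pmf ?F"] by (simp only: map_bind_pmf map_pmf_comp)
  also have "\<dots> = bind_pmf (uniform_perm_pmf n) (\<lambda>g. bind_pmf (uniform_perm_pmf m)
      (\<lambda>h. bind_pmf ?U (\<lambda>\<sigma>. return_pmf (?F (\<sigma> \<circ> c g h)))))"
    by (simp only: map_pmf_def)
  also have "\<dots> = bind_pmf (uniform_perm_pmf n) (\<lambda>g. bind_pmf (uniform_perm_pmf m)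
      (\<lambda>h. bind_pmf ?U (\<lambda>\<sigma>. return_pmf (longest_following r k w n (\<lambda>i. \<sigma> (g i)),
         longest_following r k w m (\<lambda>i. \<sigma> (n + h i))))))"
    by (intro bind_pmf_cong refl) (simp only: F set_uniform_perm_pmf mem_Collect_eq)
  \<comment> \<open>With \<open>\<sigma>\<close> drawn first and held fixed, one entry depends on
    \<open>g\<close> alone and the other on \<open>h\<close> alone, and these are
    independent.\<close>
  also have "\<dots> = bind_pmf ?U (\<lambda>\<sigma>. bind_pmf (uniform_perm_pmf n) (\<lambda>g. bind_pmf (uniform_perm_pmf m)
      (\<lambda>h. return_pmf (longest_following r k w n (\<lambda>i. \<sigma> (g i)),
         longest_following r k w m (\<lambda>i. \<sigma> (n + h i))))))"
    by (simp only: bind_commute_pmf[of _ ?U])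
  also have "\<dots> = bind_pmf ?U (\<lambda>\<sigma>. pair_pmf
      (map_pmf (\<lambda>g. longest_following r k w n (\<lambda>i. \<sigma> (g i))) (uniform_perm_pmf n))
      (map_pmf (\<lambda>h. longest_following r k w m (\<lambda>i. \<sigma> (n + h i))) (uniform_perm_pmf m)))"
    by (simp add: pair_pmf_def bind_map_pmf)
  also have "\<dots> = bind_pmf ?U (\<lambda>\<sigma>. ?R)"
  proof (intro bind_pmf_cong refl arg_cong2[of _ _ _ _ pair_pmf])
    fix \<sigma> assume "\<sigma> \<in> set_pmf ?U"
    then have "inj \<sigma>" unfolding set_uniform_perm_pmf by (auto intro: permutes_inj)
    then have "inj_on \<sigma> {1..n}" "inj_on (\<lambda>i. \<sigma> (n + i)) {1..m}"
      by (intro inj_onI; metis add_left_cancel injD)+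
    from this[THEN longest_following_uniform]
    show "map_pmf (\<lambda>g. longest_following r k w n (\<lambda>i. \<sigma> (g i))) (uniform_perm_pmf n)
        = map_pmf (longest_following r k w n) (uniform_perm_pmf n)"
      "map_pmf (\<lambda>h. longest_following r k w m (\<lambda>i. \<sigma> (n + h i))) (uniform_perm_pmf m)
        = map_pmf (longest_following r k w m) (uniform_perm_pmf m)" by auto
  qed
  finally show ?thesis by simp
qed

text \<open>With \<open>H\<close> the number of blocks ordered like \<open>v\<close> minus the number of blocks ordered like \<open>v'\<close>,
  the bound comes from \<open>0 \<le> \<Sum> (S - c - H / 2)\<^sup>2\<close>. Reordering a block from \<open>v\<close> to \<open>v'\<close> lowers
  \<open>S\<close> by at least 1, so \<open>S\<close> and \<open>H\<close> are correlated, while distinct blocks contribute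
  orthogonal terms to \<open>H\<close>.\<close>

lemma longest_following_variance_ge:
  assumes pat: "is_pattern r k w" and comb: "combinatorial r k w"
    and v: "v permutes {1..m}" and v': "v' permutes {1..m}"
    and spread: "longest_following r k w m v' + 4 * k < longest_following r k w m v"
  shows "real (card (perms (N * m))) * real N / (2 * fact m)
    \<le> (\<Sum>\<sigma>\<in>perms (N * m). (real (longest_following r k w (N * m) \<sigma>) - c)\<^sup>2)"
proof -
  define A where "A = perms (N * m)"
  define S where "S \<sigma> = real (longest_following r k w (N * m) \<sigma>)" for \<sigma>
  define like where "like i u \<sigma> \<longleftrightarrow>
    (\<forall>a\<in>{1..m}. \<forall>b\<in>{1..m}. \<sigma> (i * m + a) < \<sigma> (i * m + b) \<longleftrightarrow> u a < u b)" for i and u \<sigma> :: "nat \<Rightarrow> nat"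
  define X where "X i u \<sigma> = (of_bool (like i u \<sigma>) :: real)" for i u \<sigma>
  have finA: "finite A" by (simp only: A_def finite_perms)
  have block_le: "i * m + m \<le> N * m" if "i < N" for i
    using that by (metis Suc_leI add.commute mult_Suc mult_le_mono1)
  have shift: "(\<Sum>\<sigma>\<in>A. f (\<sigma> \<circ> block_perm (i * m) m g)) = (\<Sum>\<sigma>\<in>A. f \<sigma>)"
    if "i < N" "g permutes {1..m}" for i g and f :: "_ \<Rightarrow> real"
    unfolding A_def
    by (rule sum.reindex_bij_betw[OF bij_betw_perms_compose_right[OF
          block_perm_permutes[OF that(2) block_le[OF that(1)]]]])
  \<comment> \<open>Reordering block \<open>i\<close> by \<open>g\<close> turns the order
    \<open>u\<close> into \<open>u \<circ> g\<close>; by \<open>ex_g\<close> every order is reached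
    from every other, which makes all orders equally frequent.\<close>
  have like_same: "like i (u \<circ> g) (\<sigma> \<circ> block_perm (i * m) m g) \<longleftrightarrow> like i u \<sigma>"
    if g: "g permutes {1..m}" for i u g \<sigma>
  proof -
    have "like i (u \<circ> g) (\<sigma> \<circ> block_perm (i * m) m g) \<longleftrightarrow>
      (\<forall>a\<in>{1..m}. \<forall>b\<in>{1..m}. \<sigma> (i * m + g a) < \<sigma> (i * m + g b) \<longleftrightarrow> u (g a) < u (g b))"
      unfolding like_def by (intro ball_cong refl) (simp only: o_apply block_perm_in)
    also have "\<dots> \<longleftrightarrow> (\<forall>a\<in>g ` {1..m}. \<forall>b\<in>g ` {1..m}. \<sigma> (i * m + a) < \<sigma> (i * m + b) \<longleftrightarrow> u a < u b)"
      by blast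
    finally show ?thesis unfolding permutes_image[OF g] like_def .
  qed
  have like_other: "like j u (\<sigma> \<circ> block_perm (i * m) m g) \<longleftrightarrow> like j u \<sigma>" if "i \<noteq> j" for i j u g \<sigma>
  proof -
    have "block_perm (i * m) m g (j * m + a) = j * m + a" if a: "a \<in> {1..m}" for a
    proof (rule block_perm_out)
      have "i + 1 \<le> j \<or> j + 1 \<le> i" using \<open>i \<noteq> j\<close> by linarith
      then have "i * m + m \<le> j * m \<or> j * m + m \<le> i * m"
        by (metis mult_le_mono1 add_mult_distrib mult_1)
      then show "j * m + a \<notin> {i * m + 1..i * m + m}" using a by auto
    qed
    then show ?thesis unfolding like_def by (intro ball_cong refl) (simp only: o_apply)
  qed
  have ex_g: "\<exists>g. g permutes {1..m} \<and> u \<circ> g = u'" if "u permutes {1..m}" "u' permutes {1..m}" for u u'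
    using that permutes_compose[OF that(2) permutes_inv[OF that(1)]] permutes_inv_o(1)[OF that(1)]
    by (intro exI[of _ "inv u \<circ> u'"]) (simp add: comp_assoc[symmetric])
  obtain g where g: "g permutes {1..m}" "v \<circ> g = v'" using ex_g[OF v v'] by blast
  have X01: "0 \<le> X i u \<sigma>" "X i u \<sigma> * X i u \<sigma> = X i u \<sigma>" for i u \<sigma> by (simp_all add: X_def)
  have same_freq: "(\<Sum>\<sigma>\<in>A. X i u' \<sigma>) = (\<Sum>\<sigma>\<in>A. X i u \<sigma>)"
    if i: "i < N" and "u permutes {1..m}" "u' permutes {1..m}" for i u u'
  proof -
    obtain h where h: "h permutes {1..m}" "u \<circ> h = u'" using ex_g \<open>u permutes _\<close> \<open>u' permutes _\<close> by blast
    show ?thesis using shift[OF i h(1), of "X i u'"] like_same[OF h(1), of i u] by (simp add: X_def h(2))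
  qed
  have freq: "real (card A) / fact m \<le> (\<Sum>\<sigma>\<in>A. X i v \<sigma>)" if i: "i < N" for i
  proof -
    have "1 \<le> (\<Sum>u\<in>perms m. X i u \<sigma>)" if "\<sigma> \<in> A" for \<sigma>
    proof -
      have "inj \<sigma>" using that by (simp add: A_def permutes_inj)
      then have "inj_on (\<lambda>a. \<sigma> (i * m + a)) {1..m}"
        by (intro inj_onI) (metis add_left_cancel injD)
      then obtain u where u: "u permutes {1..m}"
        "\<And>a b. a \<in> {1..m} \<Longrightarrow> b \<in> {1..m} \<Longrightarrow> u a < u b \<longleftrightarrow> \<sigma> (i * m + a) < \<sigma> (i * m + b)"
        by (rule longest_following_standardization) blast
      then have "X i u \<sigma> = 1" by (simp add: X_def like_def)
      then show ?thesis using member_le_sum[of u "perms m" "\<lambda>u. X i u \<sigma>"] u(1) finite_perms X01 by simp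
    qed
    then have "real (card A) \<le> (\<Sum>\<sigma>\<in>A. \<Sum>u\<in>perms m. X i u \<sigma>)"
      using sum_mono[of A "\<lambda>_. 1" "\<lambda>\<sigma>. \<Sum>u\<in>perms m. X i u \<sigma>"] by simp
    also have "\<dots> = (\<Sum>u\<in>perms m. \<Sum>\<sigma>\<in>A. X i u \<sigma>)" by (rule sum.swap)
    also have "\<dots> = (\<Sum>u\<in>perms m. \<Sum>\<sigma>\<in>A. X i v \<sigma>)"
      by (rule sum.cong) (use same_freq[OF i v] in auto)
    also have "\<dots> = fact m * (\<Sum>\<sigma>\<in>A. X i v \<sigma>)" by (simp add: card_permutations)
    finally show ?thesis by (simp add: field_simps)
  qed
  \<comment> \<open>Two cuts isolate block \<open>i\<close>. They cost at most \<open>2 * k\<close>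
    in the lower bound for \<open>\<sigma>\<close> and \<open>2 * k\<close> in the upper bound for
    \<open>\<sigma>'\<close>, and outside the block the two agree; this is the origin of
    \<open>4 * k\<close>.\<close>
  have drop: "S (\<sigma> \<circ> block_perm (i * m) m g) + 1 \<le> S \<sigma>" if i: "i < N" and "like i v \<sigma>" for i \<sigma>
  proof -
    define b d where "b = i * m" and "d = N * m - (b + m)"
    define \<sigma>' where "\<sigma>' = \<sigma> \<circ> block_perm (i * m) m g"
    have n: "N * m = b + (m + d)" using block_le[OF i] by (simp add: b_def d_def)
    have "like i v' \<sigma>'" using like_same[OF g(1)] \<open>like i v \<sigma>\<close> g(2) by (metis \<sigma>'_def)
    have "longest_following r k w m (\<lambda>a. \<sigma> (b + a)) = longest_following r k w m v"
      "longest_following r k w m (\<lambda>a. \<sigma>' (b + a)) = longest_following r k w m v'"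
      using \<open>like i v \<sigma>\<close> \<open>like i v' \<sigma>'\<close> by (auto intro!: longest_following_cong simp: like_def b_def)
    moreover have "longest_following r k w b \<sigma> = longest_following r k w b \<sigma>'"
      by (rule longest_following_cong) (simp add: \<sigma>'_def b_def block_perm_out)
    moreover have "longest_following r k w d (\<lambda>a. \<sigma> (b + (m + a))) = longest_following r k w d (\<lambda>a. \<sigma>' (b + (m + a)))"
      by (rule longest_following_cong) (simp add: \<sigma>'_def b_def block_perm_out)
    ultimately have "longest_following r k w (N * m) \<sigma>' < longest_following r k w (N * m) \<sigma>"
      unfolding n using spread
        longest_following_superadditive[OF pat comb, of b \<sigma> "m + d"]
        longest_following_superadditive[OF pat comb, of m "\<lambda>a. \<sigma> (b + a)" d]
        longest_following_subadditive[OF pat, of b "m + d" \<sigma>']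
        longest_following_subadditive[OF pat, of m d "\<lambda>a. \<sigma>' (b + a)"]
      by simp
    then show ?thesis by (simp add: S_def \<sigma>'_def)
  qed
  define Z where "Z i \<sigma> = X i v \<sigma> - X i v' \<sigma>" for i \<sigma>
  have swap: "(\<Sum>\<sigma>\<in>A. f \<sigma> * X i v' \<sigma>) = (\<Sum>\<sigma>\<in>A. f (\<sigma> \<circ> block_perm (i * m) m g) * X i v \<sigma>)"
    if "i < N" for i f
    using shift[OF that g(1), of "\<lambda>\<sigma>. f \<sigma> * X i v' \<sigma>"] like_same[OF g(1), of i v]
    by (simp add: X_def g(2))
  have sumZ: "(\<Sum>\<sigma>\<in>A. Z i \<sigma>) = 0" if "i < N" for i
    using same_freq[OF that v v'] by (simp add: Z_def sum_subtractf)
  \<comment> \<open>Reordering block \<open>i\<close> from \<open>v\<close> to \<open>v'\<close>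
    matches the two terms of \<open>Z i\<close> with each other and leaves \<open>Z j\<close>
    unchanged, so they cancel.\<close>
  have orth: "(\<Sum>\<sigma>\<in>A. Z i \<sigma> * Z j \<sigma>) = 0" if "i < N" "i \<noteq> j" for i j
    using swap[OF that(1), of "Z j"] like_other[OF that(2)]
    by (simp add: Z_def X_def algebra_simps sum_subtractf sum.distrib)
  have diag: "(\<Sum>\<sigma>\<in>A. Z i \<sigma> * Z i \<sigma>) \<le> 2 * (\<Sum>\<sigma>\<in>A. X i v \<sigma>)" if "i < N" for i
  proof -
    have "Z i \<sigma> * Z i \<sigma> \<le> X i v \<sigma> + X i v' \<sigma>" for \<sigma> by (simp add: Z_def X_def)
    then have "(\<Sum>\<sigma>\<in>A. Z i \<sigma> * Z i \<sigma>) \<le> (\<Sum>\<sigma>\<in>A. X i v \<sigma> + X i v' \<sigma>)" by (rule sum_mono)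
    also have "\<dots> = 2 * (\<Sum>\<sigma>\<in>A. X i v \<sigma>)" by (simp add: sum.distrib same_freq[OF that v v'])
    finally show ?thesis .
  qed
  have corr: "(\<Sum>\<sigma>\<in>A. X i v \<sigma>) \<le> (\<Sum>\<sigma>\<in>A. S \<sigma> * Z i \<sigma>)" if "i < N" for i
  proof -
    have "(\<Sum>\<sigma>\<in>A. S \<sigma> * Z i \<sigma>) = (\<Sum>\<sigma>\<in>A. (S \<sigma> - S (\<sigma> \<circ> block_perm (i * m) m g)) * X i v \<sigma>)"
      using swap[OF that, of S] by (simp add: Z_def algebra_simps sum_subtractf)
    moreover have "X i v \<sigma> \<le> (S \<sigma> - S (\<sigma> \<circ> block_perm (i * m) m g)) * X i v \<sigma>" for \<sigma>
      using drop[OF that, of \<sigma>] by (cases "like i v \<sigma>") (simp_all add: X_def)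
    ultimately show ?thesis by (simp add: sum_mono)
  qed
  define H where "H \<sigma> = (\<Sum>i<N. Z i \<sigma>)" for \<sigma>
  define P where "P = (\<Sum>i<N. \<Sum>\<sigma>\<in>A. X i v \<sigma>)"
  have "(\<Sum>\<sigma>\<in>A. H \<sigma> * H \<sigma>) = (\<Sum>i<N. \<Sum>j<N. \<Sum>\<sigma>\<in>A. Z i \<sigma> * Z j \<sigma>)"
    unfolding H_def sum_product by (subst sum.swap, intro sum.cong refl, rule sum.swap)
  also have "\<dots> = (\<Sum>i<N. \<Sum>j<N. if i = j then \<Sum>\<sigma>\<in>A. Z i \<sigma> * Z i \<sigma> else 0)"
    by (intro sum.cong refl) (auto simp: orth)
  also have "\<dots> = (\<Sum>i<N. \<Sum>\<sigma>\<in>A. Z i \<sigma> * Z i \<sigma>)" by simp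
  also have "\<dots> \<le> 2 * P" unfolding P_def sum_distrib_left[of _ _ "{..<N}"]
    by (rule sum_mono) (simp add: diag)
  finally have HH: "(\<Sum>\<sigma>\<in>A. H \<sigma> * H \<sigma>) \<le> 2 * P" .
  have "P \<le> (\<Sum>i<N. \<Sum>\<sigma>\<in>A. S \<sigma> * Z i \<sigma>)" unfolding P_def by (intro sum_mono corr) simp
  also have "\<dots> = (\<Sum>\<sigma>\<in>A. S \<sigma> * H \<sigma>)" unfolding H_def sum_distrib_left by (rule sum.swap)
  finally have SH: "P \<le> (\<Sum>\<sigma>\<in>A. S \<sigma> * H \<sigma>)" .
  have "(\<Sum>\<sigma>\<in>A. H \<sigma>) = (\<Sum>i<N. \<Sum>\<sigma>\<in>A. Z i \<sigma>)" unfolding H_def by (rule sum.swap)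
  then have H0: "(\<Sum>\<sigma>\<in>A. H \<sigma>) = 0" by (simp add: sumZ)
  \<comment> \<open>With a coefficient \<open>x\<close> in place of 1/2 the bound would be
    \<open>2 * x * P - 2 * x\<^sup>2 * P\<close>, which is largest at \<open>x = 1/2\<close>. The
    shift \<open>c\<close> is free because \<open>H\<close> sums to 0.\<close>
  have "0 \<le> (\<Sum>\<sigma>\<in>A. (S \<sigma> - c - H \<sigma> / 2)\<^sup>2)" by (intro sum_nonneg) simp
  also have "\<dots> = (\<Sum>\<sigma>\<in>A. (S \<sigma> - c)\<^sup>2 - S \<sigma> * H \<sigma> + c * H \<sigma> + H \<sigma> * H \<sigma> / 4)"
    by (intro sum.cong refl) (simp add: power2_eq_square field_simps)
  also have "\<dots> = (\<Sum>\<sigma>\<in>A. (S \<sigma> - c)\<^sup>2) - (\<Sum>\<sigma>\<in>A. S \<sigma> * H \<sigma>) + c * (\<Sum>\<sigma>\<in>A. H \<sigma>)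
      + (\<Sum>\<sigma>\<in>A. H \<sigma> * H \<sigma>) / 4"
    by (simp add: sum.distrib sum_subtractf sum_distrib_left sum_divide_distrib)
  finally have half: "P / 2 \<le> (\<Sum>\<sigma>\<in>A. (S \<sigma> - c)\<^sup>2)" using HH SH H0 by simp
  have "real N * (real (card A) / fact m) \<le> P"
    unfolding P_def using sum_mono[of "{..<N}" "\<lambda>_. real (card A) / fact m"] freq by simp
  from order_trans[OF divide_right_mono[OF this, of 2] half]
  have "real N * (real (card A) / fact m) / 2 \<le> (\<Sum>\<sigma>\<in>A. (S \<sigma> - c)\<^sup>2)" by simp
  then show ?thesis unfolding A_def S_def by (simp add: mult_ac)
qed

section \<open>Almost additive sequences\<close>

text \<open>The additive sequence is the limit of \<open>a (2 ^ j * n) / 2 ^ j\<close>, as in the Hyers-Ulam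
  stability theorem.\<close>

lemma almost_additive_linear:
  fixes a :: "nat \<Rightarrow> real"
  assumes \<alpha>: "\<alpha> < 1"
    and add: "\<And>n m. n \<ge> 1 \<Longrightarrow> m \<ge> 1 \<Longrightarrow> \<bar>a (n + m) - a n - a m\<bar> \<le> K * real (n + m) powr \<alpha>"
  shows "\<exists>G C. \<forall>n\<ge>1. \<bar>a n - G * real n\<bar> \<le> C * real n powr \<alpha>"
proof -
  \<comment> \<open>The doubling error at \<open>2 ^ j * n\<close> is of order
    \<open>(2 ^ j * n) powr \<alpha>\<close>; division by \<open>2 ^ j\<close> leaves a multiple of
    \<open>q ^ j\<close>, which is summable since \<open>\<alpha> < 1\<close>.\<close>
  define q where "q = (2::real) powr (\<alpha> - 1)"
  have q: "0 < q" "q < 1" using \<alpha> by (auto simp: q_def powr_less_one)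
  define b where "b n j = a (2 ^ j * n) / 2 ^ j" for n j
  have pow: "real (2 ^ j * n) powr \<alpha> / 2 ^ j = real n powr \<alpha> * q ^ j" for n j :: nat
    by (simp add: powr_mult q_def powr_diff power_divide powr_realpow[symmetric] powr_powr powr_power mult_ac)
  have step: "\<bar>b n (Suc j) - b n j\<bar> \<le> (K * real n powr \<alpha>) * q ^ Suc j" if n: "n \<ge> 1" for n j
  proof -
    have "2 ^ j * n + 2 ^ j * n = 2 ^ Suc j * n" by simp
    moreover have "1 \<le> 2 ^ j * n" using n by simp
    ultimately have "\<bar>a (2 ^ Suc j * n) - a (2 ^ j * n) - a (2 ^ j * n)\<bar> \<le> K * real (2 ^ Suc j * n) powr \<alpha>"
      using add[of "2 ^ j * n" "2 ^ j * n"] by metis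
    then have "\<bar>a (2 ^ Suc j * n) - a (2 ^ j * n) - a (2 ^ j * n)\<bar> / 2 ^ Suc j
        \<le> K * (real (2 ^ Suc j * n) powr \<alpha> / 2 ^ Suc j)"
      by (simp add: divide_right_mono)
    moreover have "b n (Suc j) - b n j = (a (2 ^ Suc j * n) - a (2 ^ j * n) - a (2 ^ j * n)) / 2 ^ Suc j"
      by (simp add: b_def field_simps)
    ultimately show ?thesis unfolding pow by (simp add: mult_ac)
  qed
  have geo: "(\<lambda>j. (K * real n powr \<alpha>) * q ^ Suc j) sums (K * real n powr \<alpha> * (q / (1 - q)))" for n
    using sums_mult[OF geometric_sums[of q], of "K * real n powr \<alpha> * q"] q by (simp add: mult_ac)
  define g where "g n = a n + (\<Sum>j. b n (Suc j) - b n j)" for n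
  have summ: "summable (\<lambda>j. b n (Suc j) - b n j)" if "n \<ge> 1" for n
    by (rule summable_comparison_test'[OF sums_summable[OF geo[of n]]]) (use step[OF that] in auto)
  have lim: "b n \<longlonglongrightarrow> g n" if "n \<ge> 1" for n
  proof -
    have "(\<lambda>j. (\<Sum>i<j. b n (Suc i) - b n i)) \<longlonglongrightarrow> (\<Sum>j. b n (Suc j) - b n j)"
      by (rule summable_LIMSEQ[OF summ[OF that]])
    then have "(\<lambda>j. a n + (b n j - b n 0)) \<longlonglongrightarrow> g n"
      unfolding g_def sum_lessThan_telescope by (intro tendsto_intros)
    moreover have "(\<lambda>j. a n + (b n j - b n 0)) = b n" by (auto simp: b_def)
    ultimately show ?thesis by simp
  qed
  have close: "\<bar>a n - g n\<bar> \<le> K * (q / (1 - q)) * real n powr \<alpha>" if n: "n \<ge> 1" for n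
  proof -
    have "summable (\<lambda>j. norm (b n (Suc j) - b n j))"
      by (rule summable_comparison_test'[OF sums_summable[OF geo[of n]]]) (use step[OF n] in auto)
    then have "norm (\<Sum>j. b n (Suc j) - b n j) \<le> (\<Sum>j. norm (b n (Suc j) - b n j))"
      by (rule summable_norm)
    also have "\<dots> \<le> K * real n powr \<alpha> * (q / (1 - q))"
      unfolding sums_unique[OF geo[of n]]
      by (rule suminf_le) (use step[OF n] \<open>summable (\<lambda>j. norm _)\<close> sums_summable[OF geo[of n]] in auto)
    finally show ?thesis by (simp add: g_def mult_ac)
  qed
  have gadd: "g (n + m) = g n + g m" if nm: "n \<ge> 1" "m \<ge> 1" for n m
  proof -
    have "\<bar>b (n + m) j - b n j - b m j\<bar> \<le> K * real (n + m) powr \<alpha> * q ^ j" for j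
    proof -
      have "\<bar>a (2 ^ j * n + 2 ^ j * m) - a (2 ^ j * n) - a (2 ^ j * m)\<bar> \<le> K * real (2 ^ j * n + 2 ^ j * m) powr \<alpha>"
        using nm by (intro add) auto
      also have "2 ^ j * n + 2 ^ j * m = 2 ^ j * (n + m)" by (simp add: algebra_simps)
      finally have "\<bar>a (2 ^ j * (n + m)) - a (2 ^ j * n) - a (2 ^ j * m)\<bar> / 2 ^ j
          \<le> K * (real (2 ^ j * (n + m)) powr \<alpha> / 2 ^ j)"
        by (simp add: divide_right_mono)
      moreover have "b (n + m) j - b n j - b m j = (a (2 ^ j * (n + m)) - a (2 ^ j * n) - a (2 ^ j * m)) / 2 ^ j"
        by (simp add: b_def diff_divide_distrib)
      ultimately show ?thesis unfolding pow by (simp add: mult_ac)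
    qed
    then have "\<forall>\<^sub>F j in sequentially. norm (b (n + m) j - b n j - b m j) \<le> K * real (n + m) powr \<alpha> * q ^ j"
      by simp
    moreover have "(\<lambda>j. K * real (n + m) powr \<alpha> * q ^ j) \<longlonglongrightarrow> 0"
      using q by (intro tendsto_mult_right_zero LIMSEQ_power_zero) auto
    ultimately have "(\<lambda>j. b (n + m) j - b n j - b m j) \<longlonglongrightarrow> 0"
      by (rule Lim_null_comparison)
    moreover have "(\<lambda>j. b (n + m) j - b n j - b m j) \<longlonglongrightarrow> g (n + m) - g n - g m"
      using nm by (intro tendsto_diff lim) auto
    ultimately have "g (n + m) - g n - g m = 0" using LIMSEQ_unique by blast
    then show ?thesis by simp
  qed
  have "g n = g 1 * real n" if "n \<ge> 1" for n
    using that
  proof (induction n rule: nat_induct_at_least)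
    case (Suc n)
    then show ?case using gadd[of n 1] by (simp add: distrib_left)
  qed simp
  then show ?thesis using close by metis
qed

section \<open>Elementary inequalities and induction by halving\<close>

lemma square_expectation_le: "(measure_pmf.expectation p f)\<^sup>2 \<le> measure_pmf.expectation p (\<lambda>x. (f x)\<^sup>2)"
  if "finite (set_pmf p)" for f :: "'x \<Rightarrow> real"
proof -
  have [simp]: "integrable (measure_pmf p) g" for g :: "'x \<Rightarrow> real"
    by (rule integrable_measure_pmf_finite[OF that])
  have "0 \<le> measure_pmf.variance p f" by simp
  then show ?thesis by (subst (asm) measure_pmf.variance_eq) auto
qed

text \<open>Meant for moment bounds: adding one summand at a time would collect \<open>n\<close>
  coupling errors, while halving meets only logarithmically many, each dominated by the growth under
  doubling. \<open>b\<close> is the last binary digit.\<close>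

lemma halving_induct [consumes 1, case_names one halve]:
  assumes "n \<ge> (1::nat)" and "P 1" and step: "\<And>h b. h \<ge> 1 \<Longrightarrow> b < 2 \<Longrightarrow> P h \<Longrightarrow> P (2 * h + b)"
  shows "P n"
  using \<open>n \<ge> 1\<close>
proof (induction n rule: less_induct)
  case (less n)
  show ?case
  proof (cases "n = 1")
    case False
    with less.prems have "n div 2 \<ge> 1" "n div 2 < n" by auto
    then have "P (2 * (n div 2) + n mod 2)" by (intro step less.IH) auto
    then show ?thesis by simp
  qed (use assms(2) in simp)
qed

text \<open>The constant is \<open>21 ^ 4\<close>: if \<open>\<bar>x\<bar> < 20 * \<bar>d\<bar>\<close>, then \<open>\<bar>x + d\<bar> \<le> 21 * \<bar>d\<bar>\<close>.\<close>

lemma fourth_power_add_le: "(x + d) ^ 4 \<le> 5/4 * x ^ 4 + 194481 * d ^ 4" for x d :: real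
proof (cases "20 * \<bar>d\<bar> \<le> \<bar>x\<bar>")
  case True
  then have "\<bar>x + d\<bar> \<le> 21/20 * \<bar>x\<bar>" by linarith
  then have "\<bar>x + d\<bar> ^ 4 \<le> (21/20 * \<bar>x\<bar>) ^ 4" by (rule power_mono) simp
  then have "(x + d) ^ 4 \<le> (21/20) ^ 4 * x ^ 4" by (simp add: power_mult_distrib power_divide)
  \<comment> \<open>\<open>(21/20) ^ 4\<close> is about 1.216. The factor must stay below
    \<open>sqrt 2\<close>: it enters twice per doubling in \<open>Q_quadratic_bound\<close>, and
    twice its square has to be less than 4.\<close>
  also have "\<dots> \<le> 5/4 * x ^ 4" by (rule mult_right_mono) (simp_all add: power_divide)
  finally show ?thesis by (simp add: add_increasing2)
next
  case False
  then have "\<bar>x + d\<bar> \<le> 21 * \<bar>d\<bar>" by linarith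
  then have "\<bar>x + d\<bar> ^ 4 \<le> (21 * \<bar>d\<bar>) ^ 4" by (rule power_mono) simp
  then have "(x + d) ^ 4 \<le> 194481 * d ^ 4" by (simp add: power_mult_distrib)
  then show ?thesis by (simp add: add_increasing)
qed

lemma norm_iexp_diff_le: "norm (iexp x - iexp y) \<le> \<bar>x - y\<bar>"
proof -
  have "iexp x - iexp y = iexp y * (iexp (x - y) - 1)" by (simp add: algebra_simps flip: exp_add)
  then have "norm (iexp x - iexp y) = norm (iexp (x - y) - 1)" by (simp add: norm_mult)
  also have "\<dots> \<le> \<bar>x - y\<bar>" using iexp_approx1[of "x - y" 0] by simp
  finally show ?thesis .
qed

section \<open>Central limit theorem for almost additive distributions\<close>

text \<open>\<open>D n\<close> is the law of the \<open>n\<close>-th variable; \<open>J n m\<close> couples independent copies of the \<open>n\<close>-th and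
  \<open>m\<close>-th variable with the \<open>(n + m)\<close>-th variable.\<close>

locale almost_additive =
  fixes D :: "nat \<Rightarrow> real pmf" and J :: "nat \<Rightarrow> nat \<Rightarrow> (real \<times> real \<times> real) pmf" and c :: real
  assumes finite_J: "finite (set_pmf (J n m))"
    and fst_J: "map_pmf (\<lambda>(a, b, s). (a, b)) (J n m) = pair_pmf (D n) (D m)"
    and snd_J: "map_pmf (\<lambda>(a, b, s). s) (J n m) = D (n + m)"
    and close_J: "(a, b, s) \<in> set_pmf (J n m) \<Longrightarrow> \<bar>s - (a + b)\<bar> \<le> c"
begin

abbreviation E :: "nat \<Rightarrow> (real \<Rightarrow> 'b :: {banach, second_countable_topology}) \<Rightarrow> 'b" where
  "E n \<equiv> measure_pmf.expectation (D n)"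

abbreviation EJ :: "nat \<Rightarrow> nat \<Rightarrow> (real \<times> real \<times> real \<Rightarrow> 'b :: {banach, second_countable_topology}) \<Rightarrow> 'b" where
  "EJ n m \<equiv> measure_pmf.expectation (J n m)"

lemma finite_D: "finite (set_pmf (D n))"
  using finite_J[of n 0] snd_J[of n 0] by (metis add_0_right finite_imageI set_map_pmf)

lemma integrable_D [simp]: "integrable (measure_pmf (D n)) (f :: _ \<Rightarrow> 'b :: {banach, second_countable_topology})"
  by (rule integrable_measure_pmf_finite[OF finite_D])

lemma integrable_J [simp]: "integrable (measure_pmf (J n m)) (f :: _ \<Rightarrow> 'b :: {banach, second_countable_topology})"
  by (rule integrable_measure_pmf_finite[OF finite_J])

lemma c_nonneg: "0 \<le> c"
proof -
  obtain x where "x \<in> set_pmf (J 0 0)" using set_pmf_not_empty[of "J 0 0"] by blast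
  then show ?thesis using close_J by (cases x) (metis abs_ge_zero order_trans)
qed

lemma EJ_sum: "EJ n m (\<lambda>(a, b, s). f s) = E (n + m) f"
  unfolding snd_J[symmetric] by (simp add: case_prod_beta')

lemma EJ_pair: "EJ n m (\<lambda>(a, b, s). f a b) = measure_pmf.expectation (pair_pmf (D n) (D m)) (\<lambda>(a, b). f a b)"
  unfolding fst_J[symmetric] by (simp add: case_prod_beta')

lemma EJ_fst: "EJ n m (\<lambda>(a, b, s). f a) = E n f"
proof -
  have "EJ n m (\<lambda>(a, b, s). f a) = measure_pmf.expectation (pair_pmf (D n) (D m)) (\<lambda>(a, b). f a)"
    by (rule EJ_pair)
  also have "\<dots> = measure_pmf.expectation (map_pmf fst (pair_pmf (D n) (D m))) f"
    by (simp add: case_prod_beta')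
  finally show ?thesis by (simp only: map_fst_pair_pmf)
qed

lemma EJ_snd: "EJ n m (\<lambda>(a, b, s). f b) = E m f"
proof -
  have "EJ n m (\<lambda>(a, b, s). f b) = measure_pmf.expectation (pair_pmf (D n) (D m)) (\<lambda>(a, b). f b)"
    by (rule EJ_pair)
  also have "\<dots> = measure_pmf.expectation (map_pmf snd (pair_pmf (D n) (D m))) f"
    by (simp add: case_prod_beta')
  finally show ?thesis by (simp only: map_snd_pair_pmf)
qed

lemma EJ_prod:
  fixes f g :: "real \<Rightarrow> 'b :: {real_normed_field, banach, second_countable_topology}"
  shows "EJ n m (\<lambda>(a, b, s). f a * g b) = E n f * E m g"
proof -
  have "EJ n m (\<lambda>(a, b, s). f a * g b) = (\<Sum>(a, b)\<in>set_pmf (D n) \<times> set_pmf (D m).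
      pmf (pair_pmf (D n) (D m)) (a, b) *\<^sub>R (f a * g b))"
    unfolding EJ_pair
    by (subst integral_measure_pmf[of "set_pmf (D n) \<times> set_pmf (D m)"]) (auto simp: finite_D case_prod_beta')
  also have "\<dots> = (\<Sum>a\<in>set_pmf (D n). \<Sum>b\<in>set_pmf (D m).
      (pmf (D n) a *\<^sub>R f a) * (pmf (D m) b *\<^sub>R g b))"
    by (subst sum.cartesian_product[symmetric]) (simp add: pmf_pair mult_ac)
  also have "\<dots> = E n f * E m g"
    by (subst (1 2) integral_measure_pmf[OF finite_D]) (auto simp: sum_product)
  finally show ?thesis .
qed

lemma EJ_mono:
  fixes f g :: "_ \<Rightarrow> real"
  assumes "\<And>a b s. (a, b, s) \<in> set_pmf (J n m) \<Longrightarrow> f (a, b, s) \<le> g (a, b, s)"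
  shows "EJ n m f \<le> EJ n m g"
  by (rule integral_mono_AE) (use assms in \<open>auto simp: AE_measure_pmf_iff\<close>)

lemma almost_additive_mean: "\<bar>E (n + m) (\<lambda>x. x) - E n (\<lambda>x. x) - E m (\<lambda>x. x)\<bar> \<le> c"
proof -
  have "E (n + m) (\<lambda>x. x) - E n (\<lambda>x. x) - E m (\<lambda>x. x) = EJ n m (\<lambda>(a, b, s). s - a - b)"
    using EJ_sum[of n m "\<lambda>x. x"] EJ_fst[of n m "\<lambda>x. x"] EJ_snd[of n m "\<lambda>x. x"]
    by (simp add: case_prod_beta')
  moreover have "EJ n m (\<lambda>(a, b, s). s - a - b) \<le> EJ n m (\<lambda>_. c)"
    "EJ n m (\<lambda>_. - c) \<le> EJ n m (\<lambda>(a, b, s). s - a - b)"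
    by (rule EJ_mono; use close_J in force)+
  ultimately show ?thesis by simp
qed

text \<open>The means are themselves additive up to \<open>c\<close>, so centering at most doubles
  the coupling error.\<close>

lemma centered:
  defines "e \<equiv> \<lambda>n. E n (\<lambda>x. x)"
  shows "almost_additive (\<lambda>n. map_pmf (\<lambda>x. x - e n) (D n))
    (\<lambda>n m. map_pmf (\<lambda>(a, b, s). (a - e n, b - e m, s - e (n + m))) (J n m)) (2 * c)"
proof
  fix n m
  let ?J = "map_pmf (\<lambda>(a, b, s). (a - e n, b - e m, s - e (n + m))) (J n m)"
  show "finite (set_pmf ?J)" by (simp add: finite_J)
  have "map_pmf (\<lambda>(a, b, s). (a, b)) ?J = map_pmf (\<lambda>(a, b). (a - e n, b - e m)) (pair_pmf (D n) (D m))"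
    unfolding fst_J[symmetric] by (simp add: map_pmf_comp case_prod_beta')
  then show "map_pmf (\<lambda>(a, b, s). (a, b)) ?J =
      pair_pmf (map_pmf (\<lambda>x. x - e n) (D n)) (map_pmf (\<lambda>x. x - e m) (D m))"
    by (simp only: map_pair)
  show "map_pmf (\<lambda>(a, b, s). s) ?J = map_pmf (\<lambda>x. x - e (n + m)) (D (n + m))"
    unfolding snd_J[symmetric] by (simp add: map_pmf_comp case_prod_beta')
  fix a b s assume "(a, b, s) \<in> set_pmf ?J"
  then obtain a' b' s' where x: "(a', b', s') \<in> set_pmf (J n m)"
    "a = a' - e n" "b = b' - e m" "s = s' - e (n + m)" by auto
  show "\<bar>s - (a + b)\<bar> \<le> 2 * c"
    using close_J[OF x(1)] almost_additive_mean[of n m] x(2-4) unfolding e_def by linarith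
qed

end

section \<open>Second and fourth moments of centered laws\<close>

locale almost_additive_centered = almost_additive +
  assumes mean_zero: "measure_pmf.expectation (D n) (\<lambda>x. x) = 0"
begin

definition V :: "nat \<Rightarrow> real" where "V n = E n (\<lambda>x. x\<^sup>2)"

definition Q :: "nat \<Rightarrow> real" where "Q n = E n (\<lambda>x. x ^ 4)"

lemma V_nonneg: "0 \<le> V n" unfolding V_def by simp

lemma Q_nonneg: "0 \<le> Q n" unfolding Q_def by simp

lemma EJ_square: "EJ n m (\<lambda>(a, b, s). (a + b)\<^sup>2) = V n + V m"
proof -
  have "EJ n m (\<lambda>(a, b, s). (a + b)\<^sup>2) = EJ n m (\<lambda>x. (case x of (a, b, s) \<Rightarrow> a\<^sup>2)
      + (case x of (a, b, s) \<Rightarrow> b\<^sup>2) + 2 * (case x of (a, b, s) \<Rightarrow> a * b))"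
    by (rule arg_cong[of _ _ "EJ n m"]) (auto simp: power2_eq_square algebra_simps)
  also have "\<dots> = EJ n m (\<lambda>(a, b, s). a\<^sup>2) + EJ n m (\<lambda>(a, b, s). b\<^sup>2) + 2 * EJ n m (\<lambda>(a, b, s). a * b)"
    by (simp add: case_prod_beta')
  finally show ?thesis
    unfolding EJ_fst EJ_snd EJ_prod by (simp add: mean_zero V_def)
qed

text \<open>Independence and \<open>mean_zero\<close> remove the terms of odd degree in
  \<open>a\<close> or \<open>b\<close>.\<close>

lemma EJ_fourth_power: "EJ n m (\<lambda>(a, b, s). (a + b) ^ 4) = Q n + 6 * V n * V m + Q m"
proof -
  have "EJ n m (\<lambda>(a, b, s). (a + b) ^ 4) = EJ n m (\<lambda>x. (case x of (a, b, s) \<Rightarrow> a ^ 4)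
      + (case x of (a, b, s) \<Rightarrow> b ^ 4) + 4 * (case x of (a, b, s) \<Rightarrow> a ^ 3 * b)
      + 4 * (case x of (a, b, s) \<Rightarrow> a * b ^ 3) + 6 * (case x of (a, b, s) \<Rightarrow> a\<^sup>2 * b\<^sup>2))"
    by (rule arg_cong[of _ _ "EJ n m"]) (auto simp: power2_eq_square power3_eq_cube power4_eq_xxxx algebra_simps)
  also have "\<dots> = EJ n m (\<lambda>(a, b, s). a ^ 4) + EJ n m (\<lambda>(a, b, s). b ^ 4)
      + 4 * EJ n m (\<lambda>(a, b, s). a ^ 3 * b) + 4 * EJ n m (\<lambda>(a, b, s). a * b ^ 3)
      + 6 * EJ n m (\<lambda>(a, b, s). a\<^sup>2 * b\<^sup>2)"
    by (simp add: case_prod_beta')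
  finally show ?thesis
    unfolding EJ_fst EJ_snd EJ_prod by (simp add: mean_zero V_def Q_def)
qed

lemma E_abs_le: "E n (\<lambda>x. \<bar>x\<bar>) \<le> sqrt (V n)"
  using square_expectation_le[OF finite_D, of n "\<lambda>x. \<bar>x\<bar>"] by (intro real_le_rsqrt) (simp add: V_def)

text \<open>A coupling error \<open>d\<close> changes the square by
  \<open>2 * (a + b) * d + d\<^sup>2\<close>, so variances are additive only up to the order of a
  standard deviation. This is why \<open>almost_additive_linear\<close> admits a growing
  error.\<close>

lemma V_add: "\<bar>V (n + m) - V n - V m\<bar> \<le> 2 * c * sqrt (V n + V m) + c\<^sup>2"
proof -
  have abs: "EJ n m (\<lambda>(a, b, s). \<bar>a + b\<bar>) \<le> sqrt (V n + V m)"
    using square_expectation_le[OF finite_J, of n m "\<lambda>(a, b, s). \<bar>a + b\<bar>"] EJ_square[of n m]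
    by (intro real_le_rsqrt) (simp add: case_prod_beta')
  have pt: "\<bar>s\<^sup>2 - (a + b)\<^sup>2\<bar> \<le> 2 * c * \<bar>a + b\<bar> + c\<^sup>2" if "(a, b, s) \<in> set_pmf (J n m)" for a b s
  proof -
    define d where "d = s - (a + b)"
    have d: "\<bar>d\<bar> \<le> c" using close_J[OF that] by (simp add: d_def)
    have "s\<^sup>2 - (a + b)\<^sup>2 = 2 * (a + b) * d + d\<^sup>2" by (simp add: d_def power2_eq_square algebra_simps)
    then have "\<bar>s\<^sup>2 - (a + b)\<^sup>2\<bar> \<le> \<bar>2 * (a + b) * d\<bar> + \<bar>d\<^sup>2\<bar>" by (simp only: abs_triangle_ineq)
    moreover have "\<bar>2 * (a + b) * d\<bar> \<le> 2 * \<bar>a + b\<bar> * c"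
      using mult_left_mono[OF d, of "2 * \<bar>a + b\<bar>"] by (simp only: abs_mult abs_numeral) simp
    moreover have "\<bar>d\<^sup>2\<bar> \<le> c\<^sup>2" using power_mono[OF d, of 2] by simp
    moreover have "2 * \<bar>a + b\<bar> * c = 2 * c * \<bar>a + b\<bar>" by simp
    ultimately show ?thesis by linarith
  qed
  have "V (n + m) - V n - V m = EJ n m (\<lambda>(a, b, s). s\<^sup>2) - EJ n m (\<lambda>(a, b, s). (a + b)\<^sup>2)"
    by (simp add: EJ_square EJ_sum[of n m "\<lambda>x. x\<^sup>2"] V_def)
  also have "\<dots> = EJ n m (\<lambda>(a, b, s). s\<^sup>2 - (a + b)\<^sup>2)" by (simp add: case_prod_beta')
  finally have *: "V (n + m) - V n - V m = EJ n m (\<lambda>(a, b, s). s\<^sup>2 - (a + b)\<^sup>2)" .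
  have "EJ n m (\<lambda>(a, b, s). s\<^sup>2 - (a + b)\<^sup>2) \<le> EJ n m (\<lambda>(a, b, s). 2 * c * \<bar>a + b\<bar> + c\<^sup>2)"
    "EJ n m (\<lambda>(a, b, s). - (2 * c * \<bar>a + b\<bar> + c\<^sup>2)) \<le> EJ n m (\<lambda>(a, b, s). s\<^sup>2 - (a + b)\<^sup>2)"
    by (rule EJ_mono; use pt in fastforce)+
  moreover have "EJ n m (\<lambda>(a, b, s). 2 * c * \<bar>a + b\<bar> + c\<^sup>2) = 2 * c * EJ n m (\<lambda>(a, b, s). \<bar>a + b\<bar>) + c\<^sup>2"
    by (simp add: case_prod_beta')
  moreover have "EJ n m (\<lambda>(a, b, s). - (2 * c * \<bar>a + b\<bar> + c\<^sup>2)) = - (2 * c * EJ n m (\<lambda>(a, b, s). \<bar>a + b\<bar>) + c\<^sup>2)"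
    by (simp add: case_prod_beta')
  moreover have "2 * c * EJ n m (\<lambda>(a, b, s). \<bar>a + b\<bar>) \<le> 2 * c * sqrt (V n + V m)"
    using abs c_nonneg by (intro mult_left_mono) auto
  ultimately show ?thesis using * by linarith
qed

text \<open>The upper bound in \<open>V_add\<close> is a completed square; in effect this is the
  triangle inequality for the quadratic mean.\<close>

lemma sqrt_V_add: "sqrt (V (n + m)) \<le> sqrt (V n + V m) + c"
proof (rule real_le_lsqrt)
  show "V (n + m) \<le> (sqrt (V n + V m) + c)\<^sup>2"
    using V_add[of n m] V_nonneg[of n] V_nonneg[of m] by (simp add: power2_sum algebra_simps abs_le_iff)
qed (use V_nonneg c_nonneg in auto)

text \<open>The error in \<open>V_add\<close> involves \<open>V\<close> itself, so a crude linear
  bound must come first, to make that error of order \<open>sqrt (real (n + m))\<close>.\<close>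

lemma V_linear_bound: "\<exists>K\<ge>0. \<forall>n\<ge>1. V n \<le> K * real n"
proof -
  \<comment> \<open>One \<open>c\<close> pays for doubling, and \<open>c + sqrt (V 1)\<close> for
    appending a last odd summand.\<close>
  define c1 where "c1 = 2 * c + sqrt (V 1)"
  define d where "d = c1 / (sqrt 2 - 1)"
  define K where "K = sqrt (V 1) + d"
  have s2: "sqrt 2 > 1" by simp
  have c1: "0 \<le> c1" using c_nonneg V_nonneg by (simp add: c1_def)
  then have d: "0 \<le> d" using s2 by (simp add: d_def)
  have dc: "sqrt 2 * d = d + c1" using s2 by (simp add: d_def field_simps)
  have K: "0 \<le> K" using d V_nonneg by (simp add: K_def)
  \<comment> \<open>Subtracting \<open>d\<close> makes the claim inductive: doubling turns
    \<open>- d\<close> into \<open>- sqrt 2 * d\<close>, and by \<open>dc\<close> the gain absorbs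
    the error \<open>c1\<close>.\<close>
  have "sqrt (V n) \<le> K * sqrt (real n) - d" if "n \<ge> 1" for n
    using that
  proof (induction n rule: halving_induct)
    case one
    show ?case by (simp add: K_def)
  next
    case (halve h b)
    have dbl: "sqrt (V (2 * h)) \<le> sqrt 2 * sqrt (V h) + c"
    proof -
      have "V h + V h = 2 * V h" by simp
      then have "sqrt (V h + V h) = sqrt 2 * sqrt (V h)" by (simp only: real_sqrt_mult)
      then show ?thesis using sqrt_V_add[of h h] by (simp only: mult_2)
    qed
    have "sqrt (V (2 * h + b)) \<le> sqrt (V (2 * h)) + sqrt (V 1) + c"
    proof (cases "b = 0")
      case True
      then show ?thesis using c_nonneg V_nonneg[of 1] by simp
    next
      case False
      then have "b = 1" using halve by simp
      then show ?thesis using sqrt_V_add[of "2 * h" 1] sqrt_add_le_add_sqrt[OF V_nonneg V_nonneg, of "2 * h" 1]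
        by simp
    qed
    also have "\<dots> \<le> sqrt 2 * sqrt (V h) + c1" using dbl by (simp add: c1_def)
    also have "\<dots> \<le> sqrt 2 * (K * sqrt (real h) - d) + c1"
      using halve.IH by (intro add_right_mono mult_left_mono) auto
    also have "\<dots> = K * sqrt (real (2 * h)) - d" using dc by (simp add: algebra_simps real_sqrt_mult)
    also have "\<dots> \<le> K * sqrt (real (2 * h + b)) - d"
      using K by (intro diff_right_mono mult_left_mono) auto
    finally show ?case .
  qed
  then have "V n \<le> K\<^sup>2 * real n" if "n \<ge> 1" for n
  proof -
    have "sqrt (V n) \<le> K * sqrt (real n)" using \<open>n \<ge> 1 \<Longrightarrow> _\<close>[OF that] d by linarith
    then have "(sqrt (V n))\<^sup>2 \<le> (K * sqrt (real n))\<^sup>2" using V_nonneg by (intro power_mono) auto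
    then show ?thesis using V_nonneg by (simp add: power_mult_distrib)
  qed
  then show ?thesis by (intro exI[of _ "K\<^sup>2"]) auto
qed

lemma V_linear: "\<exists>v C. \<forall>n\<ge>1. \<bar>V n - v * real n\<bar> \<le> C * real n powr (1/2)"
proof -
  obtain K where K: "K \<ge> 0" "\<And>n. n \<ge> 1 \<Longrightarrow> V n \<le> K * real n" using V_linear_bound by blast
  show ?thesis
  proof (rule almost_additive_linear)
    fix n m :: nat assume nm: "n \<ge> 1" "m \<ge> 1"
    have "V n + V m \<le> K * real (n + m)" using K(2)[OF nm(1)] K(2)[OF nm(2)] by (simp add: algebra_simps)
    then have "sqrt (V n + V m) \<le> sqrt K * sqrt (real (n + m))"
      by (simp add: real_sqrt_mult[symmetric])
    then have "2 * c * sqrt (V n + V m) \<le> 2 * c * (sqrt K * sqrt (real (n + m)))"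
      using c_nonneg by (intro mult_left_mono) auto
    moreover have "c\<^sup>2 * 1 \<le> c\<^sup>2 * sqrt (real (n + m))"
      using nm by (intro mult_left_mono) auto
    ultimately have "\<bar>V (n + m) - V n - V m\<bar> \<le> (2 * c * sqrt K + c\<^sup>2) * sqrt (real (n + m))"
      using V_add[of n m] by (simp add: algebra_simps)
    then show "\<bar>V (n + m) - V n - V m\<bar> \<le> (2 * c * sqrt K + c\<^sup>2) * real (n + m) powr (1/2)"
      by (simp add: powr_half_sqrt)
  qed simp
qed

lemma Q_add: "Q (n + m) \<le> 5/4 * (Q n + 6 * V n * V m + Q m) + 194481 * c ^ 4"
proof -
  have "Q (n + m) = EJ n m (\<lambda>(a, b, s). s ^ 4)" by (simp add: EJ_sum[of n m "\<lambda>x. x ^ 4"] Q_def)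
  also have "\<dots> \<le> EJ n m (\<lambda>(a, b, s). 5/4 * (a + b) ^ 4 + 194481 * c ^ 4)"
  proof (rule EJ_mono)
    fix a b s assume "(a, b, s) \<in> set_pmf (J n m)"
    then have "\<bar>s - (a + b)\<bar> ^ 4 \<le> c ^ 4" using close_J by (intro power_mono) auto
    then show "(case (a, b, s) of (a, b, s) \<Rightarrow> s ^ 4) \<le>
        (case (a, b, s) of (a, b, s) \<Rightarrow> 5/4 * (a + b) ^ 4 + 194481 * c ^ 4)"
      using fourth_power_add_le[of "a + b" "s - (a + b)"] by simp
  qed
  also have "\<dots> = 5/4 * EJ n m (\<lambda>(a, b, s). (a + b) ^ 4) + 194481 * c ^ 4"
    by (simp add: case_prod_beta')
  finally show ?thesis by (simp only: EJ_fourth_power)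
qed

lemma Q_quadratic_bound: "\<exists>B\<ge>0. \<forall>n\<ge>1. Q n \<le> B * (real n)\<^sup>2"
proof -
  obtain K where K: "K \<ge> 0" "\<And>n. n \<ge> 1 \<Longrightarrow> V n \<le> K * real n" using V_linear_bound by blast
  define w where "w = 194481 * c ^ 4"
  have w: "0 \<le> w" by (simp add: w_def)
  \<comment> \<open>Collects everything but the \<open>Q h\<close> term after two uses of
    \<open>Q_add\<close>, one for \<open>2 * h\<close> and one for an extra summand.\<close>
  define C where "C = 75/8 * K\<^sup>2 + 15 * K * V 1 + 5/4 * Q 1 + 9/4 * w"
  have C: "0 \<le> C" using K(1) V_nonneg Q_nonneg w by (simp add: C_def)
  \<comment> \<open>The point is that 25/8, which is \<open>2 * (5/4)\<^sup>2\<close>, is less than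
    4, the factor by which a quadratic grows under doubling.\<close>
  have dbl: "Q (2 * h + b) \<le> 25/8 * Q h + C * (real h)\<^sup>2" if h: "h \<ge> 1" "b < 2" for h b
  proof -
    have h1: "1 \<le> real h" using h by simp
    then have hh: "real h \<le> (real h)\<^sup>2" "1 \<le> (real h)\<^sup>2"
      using mult_mono[OF h1 h1] by (simp_all add: power2_eq_square)
    have "V h * V h \<le> (K * real h) * (K * real h)" using K h V_nonneg by (intro mult_mono) auto
    then have VV: "V h * V h \<le> K\<^sup>2 * (real h)\<^sup>2" by (simp add: power2_eq_square mult_ac)
    define p q s t where "p = K\<^sup>2 * (real h)\<^sup>2" and "q = K * V 1 * (real h)\<^sup>2"
      and "s = Q 1 * (real h)\<^sup>2" and "t = w * (real h)\<^sup>2"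
    note pqst = p_def q_def s_def t_def
    have two: "Q (2 * h) \<le> 5/4 * (2 * Q h + 6 * p) + w"
    proof -
      have "5/4 * (Q h + 6 * (V h * V h) + Q h) \<le> 5/4 * (2 * Q h + 6 * p)"
        unfolding p_def using VV by (intro mult_left_mono) simp_all
      then show ?thesis using Q_add[of h h] by (simp only: w_def mult_2 mult.assoc)
    qed
    have wh: "w \<le> t" "Q 1 \<le> s"
      using hh(2) w Q_nonneg[of 1] by (simp_all add: pqst mult_le_cancel_left1)
    have nonneg: "0 \<le> q" "0 \<le> p" using K(1) V_nonneg by (simp_all add: pqst)
    have Ch: "C * (real h)\<^sup>2 = 75/8 * p + 15 * q + 5/4 * s + 9/4 * t"
      by (simp add: C_def pqst algebra_simps)
    show ?thesis
    proof (cases "b = 0")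
      case True
      then show ?thesis
        using two[unfolded distrib_left] wh nonneg Ch Q_nonneg[of h] Q_nonneg[of 1] w by simp
    next
      case False
      then have b: "b = 1" using h by simp
      have "V (2 * h) \<le> 2 * K * real h" using K(2)[of "2 * h"] h by simp
      then have "V (2 * h) * V 1 \<le> 2 * K * real h * V 1" using V_nonneg by (intro mult_right_mono) auto
      also have "\<dots> \<le> 2 * K * (real h)\<^sup>2 * V 1"
        using hh(1) K(1) V_nonneg by (intro mult_right_mono mult_left_mono) auto
      finally have VV1: "V (2 * h) * V 1 \<le> 2 * q" by (simp add: q_def mult_ac)
      have "Q (2 * h + 1) \<le> 5/4 * (Q (2 * h) + 6 * (V (2 * h) * V 1) + Q 1) + w"
        using Q_add[of "2 * h" 1] unfolding w_def by (simp only: mult.assoc)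
      also have "\<dots> \<le> 5/4 * (5/4 * (2 * Q h + 6 * p) + w + 6 * (2 * q) + Q 1) + w"
        using two VV1 by (intro add_mono mult_left_mono) auto
      also have "\<dots> \<le> 25/8 * Q h + C * (real h)\<^sup>2"
        unfolding Ch distrib_left using wh by simp
      finally show ?thesis unfolding b .
    qed
  qed
  \<comment> \<open>Large enough that \<open>25/8 * B + C \<le> 4 * B\<close>, and that the case
    \<open>n = 1\<close> holds.\<close>
  define B where "B = Q 1 + 2 * C"
  have B: "0 \<le> B" using C Q_nonneg by (simp add: B_def)
  have "Q n \<le> B * (real n)\<^sup>2" if "n \<ge> 1" for n
    using that
  proof (induction n rule: halving_induct)
    case one
    show ?case using C by (simp add: B_def)
  next
    case (halve h b)
    have "C * 2 \<le> B" using Q_nonneg by (simp add: B_def)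
    then have CB: "C * 2 * (real h)\<^sup>2 \<le> B * (real h)\<^sup>2" by (rule mult_right_mono) simp
    have nn: "0 \<le> B * (real h)\<^sup>2" using B by simp
    have "Q (2 * h + b) \<le> 25/8 * (B * (real h)\<^sup>2) + C * (real h)\<^sup>2"
      using dbl[OF halve.hyps] halve.IH by linarith
    also have "\<dots> \<le> B * (2 * real h)\<^sup>2" using CB nn by (simp add: power_mult_distrib)
    also have "\<dots> \<le> B * (real (2 * h + b))\<^sup>2" using B by (intro mult_left_mono power_mono) auto
    finally show ?case .
  qed
  with B show ?thesis by blast
qed


section \<open>Characteristic functions of the centered laws\<close>

definition \<phi> :: "nat \<Rightarrow> real \<Rightarrow> complex" where "\<phi> n \<theta> = E n (\<lambda>x. iexp (\<theta> * x))"

lemma norm_\<phi>_le_1: "norm (\<phi> n \<theta>) \<le> 1"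
proof -
  have "norm (\<phi> n \<theta>) \<le> E n (\<lambda>x. norm (iexp (\<theta> * x)))" unfolding \<phi>_def by (rule integral_norm_bound)
  then show ?thesis by simp
qed

lemma \<phi>_add: "norm (\<phi> (n + m) \<theta> - \<phi> n \<theta> * \<phi> m \<theta>) \<le> c * \<bar>\<theta>\<bar>"
proof -
  have "\<phi> n \<theta> * \<phi> m \<theta> = EJ n m (\<lambda>(a, b, s). iexp (\<theta> * a) * iexp (\<theta> * b))"
    unfolding EJ_prod \<phi>_def ..
  also have "\<dots> = EJ n m (\<lambda>(a, b, s). iexp (\<theta> * (a + b)))"
    by (rule arg_cong[of _ _ "EJ n m"]) (simp add: algebra_simps flip: exp_add)
  finally have "\<phi> (n + m) \<theta> - \<phi> n \<theta> * \<phi> m \<theta>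
      = EJ n m (\<lambda>(a, b, s). iexp (\<theta> * s)) - EJ n m (\<lambda>(a, b, s). iexp (\<theta> * (a + b)))"
    unfolding EJ_sum \<phi>_def by simp
  also have "\<dots> = EJ n m (\<lambda>(a, b, s). iexp (\<theta> * s) - iexp (\<theta> * (a + b)))"
    by (simp add: case_prod_beta')
  finally have "norm (\<phi> (n + m) \<theta> - \<phi> n \<theta> * \<phi> m \<theta>)
      \<le> EJ n m (\<lambda>x. norm (case x of (a, b, s) \<Rightarrow> iexp (\<theta> * s) - iexp (\<theta> * (a + b))))"
    using integral_norm_bound by metis
  also have "\<dots> \<le> EJ n m (\<lambda>_. c * \<bar>\<theta>\<bar>)"
  proof (rule EJ_mono)
    fix a b s assume x: "(a, b, s) \<in> set_pmf (J n m)"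
    have "norm (iexp (\<theta> * s) - iexp (\<theta> * (a + b))) \<le> \<bar>\<theta> * s - \<theta> * (a + b)\<bar>"
      by (rule norm_iexp_diff_le)
    also have "\<theta> * s - \<theta> * (a + b) = \<theta> * (s - (a + b))" by (simp only: right_diff_distrib)
    also have "\<bar>\<dots>\<bar> \<le> c * \<bar>\<theta>\<bar>"
      using mult_right_mono[OF close_J[OF x], of "\<bar>\<theta>\<bar>"] by (simp only: abs_mult mult.commute)
    finally show "norm (case (a, b, s) of (a, b, s) \<Rightarrow> iexp (\<theta> * s) - iexp (\<theta> * (a + b))) \<le> c * \<bar>\<theta>\<bar>"
      by simp
  qed
  finally show ?thesis by simp
qed

text \<open>Characteristic functions have norm at most 1, so the error of each joined block is added
  without amplification.\<close>

lemma \<phi>_power: "norm (\<phi> (r + N * m) \<theta> - \<phi> r \<theta> * \<phi> m \<theta> ^ N) \<le> real N * (c * \<bar>\<theta>\<bar>)"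
proof (induction N)
  case (Suc N)
  have "\<phi> (r + Suc N * m) \<theta> - \<phi> r \<theta> * \<phi> m \<theta> ^ Suc N
      = (\<phi> ((r + N * m) + m) \<theta> - \<phi> (r + N * m) \<theta> * \<phi> m \<theta>)
        + (\<phi> (r + N * m) \<theta> - \<phi> r \<theta> * \<phi> m \<theta> ^ N) * \<phi> m \<theta>"
    by (simp add: algebra_simps)
  also have "norm \<dots> \<le> norm (\<phi> ((r + N * m) + m) \<theta> - \<phi> (r + N * m) \<theta> * \<phi> m \<theta>)
      + norm (\<phi> (r + N * m) \<theta> - \<phi> r \<theta> * \<phi> m \<theta> ^ N) * norm (\<phi> m \<theta>)"
    by (rule order_trans[OF norm_triangle_ineq]) (simp add: norm_mult)
  also have "\<dots> \<le> c * \<bar>\<theta>\<bar> + real N * (c * \<bar>\<theta>\<bar>) * 1"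
    by (intro add_mono \<phi>_add mult_mono Suc norm_\<phi>_le_1) (use c_nonneg in auto)
  also have "\<dots> = real (Suc N) * (c * \<bar>\<theta>\<bar>)" by (simp add: algebra_simps)
  finally show ?case .
qed simp

text \<open>Disposes of the short remainder block left after cutting into equal blocks.\<close>

lemma \<phi>_close_1: "norm (\<phi> n \<theta> - 1) \<le> sqrt (V n) * \<bar>\<theta>\<bar>"
proof -
  have "\<phi> n \<theta> - 1 = E n (\<lambda>x. iexp (\<theta> * x) - 1)" by (simp add: \<phi>_def)
  also have "norm \<dots> \<le> E n (\<lambda>x. norm (iexp (\<theta> * x) - 1))" by (rule integral_norm_bound)
  also have "\<dots> \<le> E n (\<lambda>x. \<bar>x\<bar> * \<bar>\<theta>\<bar>)"
  proof (rule integral_mono)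
    fix x
    show "norm (iexp (\<theta> * x) - 1) \<le> \<bar>x\<bar> * \<bar>\<theta>\<bar>"
      using norm_iexp_diff_le[of "\<theta> * x" 0] by (simp add: abs_mult mult.commute)
  qed simp_all
  also have "\<dots> = E n (\<lambda>x. \<bar>x\<bar>) * \<bar>\<theta>\<bar>" by simp
  also have "\<dots> \<le> sqrt (V n) * \<bar>\<theta>\<bar>" by (intro mult_right_mono E_abs_le) simp
  finally show ?thesis .
qed

lemma \<phi>_taylor:
  assumes \<epsilon>: "\<epsilon> > 0"
  shows "norm (\<phi> n \<theta> - exp (- (\<theta>\<^sup>2 * V n / 2)))
    \<le> (\<epsilon> * \<theta>\<^sup>2 * V n + \<theta> ^ 4 * Q n / \<epsilon>) / 12 + \<theta> ^ 4 * (V n)\<^sup>2"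
proof -
  \<comment> \<open>The cubic remainder is split between second and fourth powers by the weighted
    inequality \<open>2 * \<bar>y\<bar> ^ 3 \<le> \<epsilon> * y\<^sup>2 + y ^ 4 /
    \<epsilon>\<close>, so that only \<open>V\<close> and \<open>Q\<close> enter.\<close>
  have taylor: "norm (iexp y - (1 + \<i> * y - y\<^sup>2 / 2)) \<le> (\<epsilon> * y\<^sup>2 + y ^ 4 / \<epsilon>) / 12" for y :: real
  proof -
    have "0 \<le> (\<epsilon> * \<bar>y\<bar> - y\<^sup>2)\<^sup>2 / \<epsilon>" using \<epsilon> by simp
    also have "\<dots> = \<epsilon> * y\<^sup>2 + y ^ 4 / \<epsilon> - 2 * \<bar>y\<bar> ^ 3"
      using \<epsilon> by (simp add: power2_eq_square power3_eq_cube power4_eq_xxxx field_simps abs_mult_self_eq flip: abs_mult)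
    finally have "\<bar>y\<bar> ^ 3 / 6 \<le> (\<epsilon> * y\<^sup>2 + y ^ 4 / \<epsilon>) / 12" by simp
    moreover have "(\<Sum>k\<le>2. (\<i> * y) ^ k / fact k) = 1 + \<i> * y - complex_of_real (y\<^sup>2) / 2"
      by (simp add: numeral_2_eq_2 power_mult_distrib)
    then have "norm (iexp y - (1 + \<i> * y - y\<^sup>2 / 2)) \<le> \<bar>y\<bar> ^ 3 / 6"
      using iexp_approx1[of y 2] by (simp add: fact_numeral eval_nat_numeral(3)[symmetric] del: power_Suc)
    ultimately show ?thesis by linarith
  qed
  have "E n (\<lambda>x. 1 + \<i> * (\<theta> * x) - (\<theta> * x)\<^sup>2 / 2) =
      1 + \<i> * \<theta> * E n (\<lambda>x. complex_of_real x) - \<theta>\<^sup>2 / 2 * E n (\<lambda>x. complex_of_real (x\<^sup>2))"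
    by (simp add: power_mult_distrib mult.assoc[symmetric])
  also have "E n (\<lambda>x. complex_of_real x) = 0" by (simp add: integral_complex_of_real mean_zero)
  also have "E n (\<lambda>x. complex_of_real (x\<^sup>2)) = of_real (V n)"
    unfolding V_def by (rule integral_complex_of_real)
  finally have eq: "1 - complex_of_real (\<theta>\<^sup>2 * V n / 2) = E n (\<lambda>x. 1 + \<i> * (\<theta> * x) - (\<theta> * x)\<^sup>2 / 2)"
    by simp
  have "norm (\<phi> n \<theta> - (1 - complex_of_real (\<theta>\<^sup>2 * V n / 2)))
      = norm (E n (\<lambda>x. iexp (\<theta> * x) - (1 + \<i> * (\<theta> * x) - (\<theta> * x)\<^sup>2 / 2)))"
    unfolding eq \<phi>_def by (subst Bochner_Integration.integral_diff[symmetric]) simp_all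
  also have "\<dots> \<le> E n (\<lambda>x. norm (iexp (\<theta> * x) - (1 + \<i> * (\<theta> * x) - (\<theta> * x)\<^sup>2 / 2)))"
    by (rule integral_norm_bound)
  also have "\<dots> \<le> E n (\<lambda>x. (\<epsilon> * (\<theta> * x)\<^sup>2 + (\<theta> * x) ^ 4 / \<epsilon>) / 12)"
    by (rule integral_mono) (use taylor in \<open>simp_all only: integrable_D of_real_mult[symmetric]\<close>)
  also have "\<dots> = (\<epsilon> * \<theta>\<^sup>2 * V n + \<theta> ^ 4 * Q n / \<epsilon>) / 12"
    by (simp add: power_mult_distrib V_def Q_def mult.assoc[symmetric])
  finally have 1: "norm (\<phi> n \<theta> - (1 - complex_of_real (\<theta>\<^sup>2 * V n / 2)))
      \<le> (\<epsilon> * \<theta>\<^sup>2 * V n + \<theta> ^ 4 * Q n / \<epsilon>) / 12" .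
  define u where "u = \<theta>\<^sup>2 * V n / 2"
  have u: "0 \<le> u" using V_nonneg by (simp add: u_def)
  have "\<bar>(1 - u) - exp (- u)\<bar> \<le> u\<^sup>2"
  proof -
    have "1 + (- u) \<le> exp (- u)" by (rule exp_ge_add_one_self)
    moreover have "exp (- u) \<le> 1 / (1 + u)"
      using exp_ge_add_one_self[of u] u by (simp add: exp_minus divide_inverse le_imp_inverse_le)
    moreover have "1 \<le> (1 - u + u\<^sup>2) * (1 + u)"
      using u by (simp add: power2_eq_square algebra_simps)
    then have "1 / (1 + u) \<le> 1 - u + u\<^sup>2" using u by (simp add: divide_le_eq)
    ultimately show ?thesis by linarith
  qed
  then have "norm (complex_of_real ((1 - u) - exp (- u))) \<le> u\<^sup>2" by (simp only: norm_of_real)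
  also have "u\<^sup>2 = \<theta> ^ 4 * (V n)\<^sup>2 / 4" by (simp add: u_def power_mult_distrib power_divide)
  also have "\<dots> \<le> \<theta> ^ 4 * (V n)\<^sup>2" by simp
  finally have 2: "norm ((1 - complex_of_real u) - exp (- u)) \<le> \<theta> ^ 4 * (V n)\<^sup>2" by simp
  have "norm (\<phi> n \<theta> - exp (- u)) \<le> norm (\<phi> n \<theta> - (1 - complex_of_real u)) + norm ((1 - complex_of_real u) - exp (- u))"
    by (rule norm_triangle_ineq[of "\<phi> n \<theta> - (1 - complex_of_real u)" "(1 - complex_of_real u) - exp (- u)", simplified])
  then show ?thesis using 1 2 unfolding u_def by linarith
qed

text \<open>Three errors add up: \<open>N\<close> couplings, the dropped remainder block, and
  \<open>N\<close> Taylor errors, since powers of numbers of norm at most 1 differ by at most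
  \<open>N\<close> times the difference of the bases.\<close>

lemma \<phi>_gaussian:
  assumes N: "N \<ge> 1" and \<epsilon>: "\<epsilon> > 0"
  shows "norm (\<phi> (r + N * m) \<theta> - exp (- (real N * (\<theta>\<^sup>2 * V m / 2))))
    \<le> (real N * c + sqrt (V r)) * \<bar>\<theta>\<bar> + real N * ((\<epsilon> * \<theta>\<^sup>2 * V m + \<theta> ^ 4 * Q m / \<epsilon>) / 12 + \<theta> ^ 4 * (V m)\<^sup>2)"
proof -
  define z where "z = complex_of_real (exp (- (\<theta>\<^sup>2 * V m / 2)))"
  have z: "norm z \<le> 1" using V_nonneg by (simp add: z_def)
  have "complex_of_real (exp (- (real N * (\<theta>\<^sup>2 * V m / 2)))) = z ^ N"
    unfolding z_def by (simp add: exp_of_nat_mult[symmetric] flip: of_real_power)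
  then have "norm (\<phi> (r + N * m) \<theta> - exp (- (real N * (\<theta>\<^sup>2 * V m / 2))))
    = norm ((\<phi> (r + N * m) \<theta> - \<phi> r \<theta> * \<phi> m \<theta> ^ N) + (\<phi> r \<theta> - 1) * \<phi> m \<theta> ^ N + (\<phi> m \<theta> ^ N - z ^ N))"
    by (simp add: algebra_simps)
  also have "\<dots> \<le> norm (\<phi> (r + N * m) \<theta> - \<phi> r \<theta> * \<phi> m \<theta> ^ N)
      + norm (\<phi> r \<theta> - 1) * norm (\<phi> m \<theta>) ^ N + norm (\<phi> m \<theta> ^ N - z ^ N)"
    by (intro order_trans[OF norm_triangle_ineq] add_right_mono) (simp add: norm_mult norm_power)
  also have "\<dots> \<le> real N * (c * \<bar>\<theta>\<bar>) + sqrt (V r) * \<bar>\<theta>\<bar> * 1 + real N * norm (\<phi> m \<theta> - z)"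
    by (intro add_mono mult_mono \<phi>_power \<phi>_close_1 power_le_one norm_power_diff norm_\<phi>_le_1 z) (use V_nonneg in auto)
  also have "\<dots> \<le> real N * (c * \<bar>\<theta>\<bar>) + sqrt (V r) * \<bar>\<theta>\<bar> * 1
      + real N * ((\<epsilon> * \<theta>\<^sup>2 * V m + \<theta> ^ 4 * Q m / \<epsilon>) / 12 + \<theta> ^ 4 * (V m)\<^sup>2)"
    using \<phi>_taylor[OF \<epsilon>, of m \<theta>] unfolding z_def by (intro add_left_mono mult_left_mono) auto
  finally show ?thesis by (simp add: algebra_simps)
qed

end

section \<open>Convergence of the characteristic functions\<close>

context almost_additive_centered
begin

text \<open>Cutting \<open>n\<close> into about \<open>n\<^sup>1\<^sup>/\<^sup>3\<close> blocks makes the total coupling error, which is proportional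
  to the number of blocks, negligible compared to \<open>sqrt n\<close>.\<close>

lemma \<phi>_limit:
  assumes v: "v > 0" and Vlin: "\<And>n. n \<ge> 1 \<Longrightarrow> \<bar>V n - v * real n\<bar> \<le> C * real n powr (1/2)"
  shows "(\<lambda>n. \<phi> n (t / (sqrt v * sqrt (real n)))) \<longlonglongrightarrow> exp (- (t\<^sup>2 / 2))"
proof -
  obtain K where K: "K \<ge> 0" "\<And>n. n \<ge> 1 \<Longrightarrow> V n \<le> K * real n" using V_linear_bound by blast
  obtain B where B: "B \<ge> 0" "\<And>n. n \<ge> 1 \<Longrightarrow> Q n \<le> B * (real n)\<^sup>2" using Q_quadratic_bound by blast
  have C: "C \<ge> 0" using Vlin[of 1] by (simp add: abs_le_iff)
  define N where "N n = nat \<lfloor>real n powr (1/3)\<rfloor>" for n :: nat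
  define m where "m n = n div N n" for n
  define r where "r n = n mod N n" for n
  define \<theta> where "\<theta> n = t / (sqrt v * sqrt (real n))" for n
  define T where "T = t\<^sup>2 / v"
  define W where "W = (K * T + B * T\<^sup>2) / 12 + K\<^sup>2 * T\<^sup>2"
  have T: "T \<ge> 0" using v by (simp add: T_def)
  have Nle: "real (N n) \<le> real n powr (1/3)" for n by (simp add: N_def)
  have N1: "N n \<ge> 1" if "n \<ge> 1" for n
  proof -
    have "1 \<le> real n powr (1/3)" using that by (intro ge_one_powr_ge_zero) auto
    then show ?thesis by (simp add: N_def le_nat_iff le_floor_iff)
  qed
  have Nn: "N n \<le> n" if "n \<ge> 1" for n
  proof -
    have "real n powr (1/3) \<le> real n powr 1" using that by (intro powr_mono) auto
    then have "real (N n) \<le> real n" using Nle[of n] by simp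
    then show ?thesis by simp
  qed
  have n_eq: "n = r n + N n * m n" for n by (simp add: r_def m_def)
  have m1: "m n \<ge> 1" if "n \<ge> 1" for n
    using Nn[OF that] N1[OF that] by (simp add: m_def div_greater_zero_iff Suc_le_eq)
  have rN: "r n < N n" if "n \<ge> 1" for n using N1[OF that] by (simp add: r_def)
  have \<theta>2: "(\<theta> n)\<^sup>2 = T / real n" for n
    using v by (simp add: \<theta>_def T_def power_divide power_mult_distrib)
  have \<theta>4: "\<theta> n ^ 4 = T\<^sup>2 / (real n)\<^sup>2" for n
  proof -
    have "\<theta> n ^ 4 = ((\<theta> n)\<^sup>2)\<^sup>2" by simp
    then show ?thesis by (simp only: \<theta>2 power_divide)
  qed
  have bound: "norm (\<phi> n (\<theta> n) - exp (- (real (N n) * ((\<theta> n)\<^sup>2 * V (m n) / 2))))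
      \<le> ((c + K) * (real n powr (1/3) / sqrt (real n)) + (V 0 + 1) * (1 / sqrt (real n))) * (\<bar>t\<bar> / sqrt v)
        + W * (1 / sqrt (real (N n)))" if n: "n \<ge> 1" for n
  proof -
    \<comment> \<open>Balances the two parts of the Taylor error: with \<open>y\<close> at most
      \<open>1 / N\<close>, both \<open>\<epsilon> * N * y\<close> and
      \<open>N * y\<^sup>2 / \<epsilon>\<close> are at most \<open>\<epsilon>\<close>.\<close>
    define \<epsilon> where "\<epsilon> = 1 / sqrt (real (N n))"
    have Npos: "real (N n) > 0" "real (N n) \<ge> 1" and npos: "real n > 0" using N1[OF n] n by simp_all
    have \<epsilon>: "\<epsilon> > 0" using Npos by (simp add: \<epsilon>_def)
    define y where "y = real (m n) / real n"
    have "real (N n * m n) \<le> real n" using n_eq[of n] by (metis le_add2 of_nat_le_iff)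
    then have y: "0 \<le> y" "real (N n) * y \<le> 1" using npos by (simp_all add: y_def)
    have "norm (\<phi> (r n + N n * m n) (\<theta> n) - exp (- (real (N n) * ((\<theta> n)\<^sup>2 * V (m n) / 2))))
      \<le> (real (N n) * c + sqrt (V (r n))) * \<bar>\<theta> n\<bar>
       + real (N n) * ((\<epsilon> * (\<theta> n)\<^sup>2 * V (m n) + \<theta> n ^ 4 * Q (m n) / \<epsilon>) / 12 + \<theta> n ^ 4 * (V (m n))\<^sup>2)"
      by (rule \<phi>_gaussian[OF N1[OF n] \<epsilon>])
    moreover have "(real (N n) * c + sqrt (V (r n))) * \<bar>\<theta> n\<bar>
      \<le> ((c + K) * (real n powr (1/3) / sqrt (real n)) + (V 0 + 1) * (1 / sqrt (real n))) * (\<bar>t\<bar> / sqrt v)"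
    proof -
      \<comment> \<open>The remainder may be empty, and the linear bound starts at 1; hence the
        extra \<open>V 0\<close>.\<close>
      have "V (r n) \<le> K * real (N n) + V 0"
      proof (cases "r n = 0")
        case False
        then have "V (r n) \<le> K * real (r n)" by (intro K(2)) simp
        also have "\<dots> \<le> K * real (N n)" using rN[OF n] K(1) by (intro mult_left_mono) auto
        finally show ?thesis using V_nonneg[of 0] by linarith
      qed (use K(1) in simp)
      moreover have "sqrt z \<le> z + 1" if "0 \<le> z" for z :: real
      proof (rule real_le_lsqrt)
        show "z \<le> (z + 1)\<^sup>2" using that by (simp add: power2_eq_square algebra_simps)
      qed (use that in auto)
      from this[OF V_nonneg[of "r n"]] have "sqrt (V (r n)) \<le> V (r n) + 1" .
      ultimately have "real (N n) * c + sqrt (V (r n)) \<le> (c + K) * real (N n) + (V 0 + 1)"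
        by (simp add: algebra_simps)
      also have "\<dots> \<le> (c + K) * real n powr (1/3) + (V 0 + 1)"
        using Nle[of n] c_nonneg K(1) by (intro add_right_mono mult_left_mono) auto
      finally have "(real (N n) * c + sqrt (V (r n))) * \<bar>\<theta> n\<bar>
        \<le> ((c + K) * real n powr (1/3) + (V 0 + 1)) * \<bar>\<theta> n\<bar>" by (rule mult_right_mono) simp
      moreover have "\<bar>\<theta> n\<bar> = (1 / sqrt (real n)) * (\<bar>t\<bar> / sqrt v)"
        using v by (simp add: \<theta>_def abs_mult)
      moreover have "((c + K) * real n powr (1/3) + (V 0 + 1)) * ((1 / sqrt (real n)) * (\<bar>t\<bar> / sqrt v))
        = ((c + K) * (real n powr (1/3) / sqrt (real n)) + (V 0 + 1) * (1 / sqrt (real n))) * (\<bar>t\<bar> / sqrt v)"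
        by (simp only: mult.assoc[symmetric] distrib_right times_divide_eq_right mult_1_right add_divide_distrib)
      ultimately show ?thesis by (simp only:)
    qed
    moreover have "real (N n) * ((\<epsilon> * (\<theta> n)\<^sup>2 * V (m n) + \<theta> n ^ 4 * Q (m n) / \<epsilon>) / 12 + \<theta> n ^ 4 * (V (m n))\<^sup>2) \<le> W * \<epsilon>"
    proof -
      have Ny2: "real (N n) * y\<^sup>2 \<le> 1 / real (N n)"
      proof -
        have "(real (N n) * y)\<^sup>2 \<le> 1" using y by (simp add: power_le_one)
        then show ?thesis using Npos by (simp add: power2_eq_square field_simps)
      qed
      have "1 / real (N n) = \<epsilon> * \<epsilon>" using Npos by (simp add: \<epsilon>_def)
      then have Ny2': "real (N n) * y\<^sup>2 \<le> \<epsilon> * \<epsilon>" using Ny2 by simp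
      have \<epsilon>1: "\<epsilon> \<le> 1" using Npos by (simp add: \<epsilon>_def)
      have "(\<theta> n)\<^sup>2 * V (m n) \<le> T / real n * (K * real (m n))"
        unfolding \<theta>2 using T K(2)[OF m1[OF n]] by (intro mult_left_mono) auto
      then have 1: "(\<theta> n)\<^sup>2 * V (m n) \<le> K * T * y" by (simp add: y_def mult_ac)
      have "\<theta> n ^ 4 * Q (m n) \<le> T\<^sup>2 / (real n)\<^sup>2 * (B * (real (m n))\<^sup>2)"
        unfolding \<theta>4 using B(2)[OF m1[OF n]] by (intro mult_left_mono) auto
      then have 2: "\<theta> n ^ 4 * Q (m n) \<le> B * T\<^sup>2 * y\<^sup>2" by (simp add: y_def power_divide mult_ac)
      have "\<theta> n ^ 4 * (V (m n))\<^sup>2 \<le> T\<^sup>2 / (real n)\<^sup>2 * (K * real (m n))\<^sup>2"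
        unfolding \<theta>4 using K(2)[OF m1[OF n]] V_nonneg by (intro mult_left_mono power_mono) auto
      then have 3: "\<theta> n ^ 4 * (V (m n))\<^sup>2 \<le> K\<^sup>2 * T\<^sup>2 * y\<^sup>2"
        by (simp add: y_def power_divide power_mult_distrib mult_ac)
      have "real (N n) * (\<epsilon> * ((\<theta> n)\<^sup>2 * V (m n))) \<le> real (N n) * (\<epsilon> * (K * T * y))"
        using 1 \<epsilon> by (intro mult_left_mono) auto
      also have "\<dots> = \<epsilon> * (K * T) * (real (N n) * y)" by simp
      also have "\<dots> \<le> \<epsilon> * (K * T) * 1" using y \<epsilon> K(1) T by (intro mult_left_mono) auto
      finally have a: "real (N n) * (\<epsilon> * ((\<theta> n)\<^sup>2 * V (m n))) \<le> K * T * \<epsilon>" by (simp add: mult_ac)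
      have "real (N n) * (\<theta> n ^ 4 * Q (m n) / \<epsilon>) \<le> real (N n) * (B * T\<^sup>2 * y\<^sup>2 / \<epsilon>)"
        using 2 \<epsilon> by (intro mult_left_mono divide_right_mono) auto
      also have "\<dots> = B * T\<^sup>2 / \<epsilon> * (real (N n) * y\<^sup>2)" by simp
      also have "\<dots> \<le> B * T\<^sup>2 / \<epsilon> * (\<epsilon> * \<epsilon>)" using Ny2' \<epsilon> B(1) by (intro mult_left_mono) auto
      finally have b: "real (N n) * (\<theta> n ^ 4 * Q (m n) / \<epsilon>) \<le> B * T\<^sup>2 * \<epsilon>" using \<epsilon> by simp
      have "real (N n) * (\<theta> n ^ 4 * (V (m n))\<^sup>2) \<le> real (N n) * (K\<^sup>2 * T\<^sup>2 * y\<^sup>2)"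
        using 3 by (intro mult_left_mono) auto
      also have "\<dots> = K\<^sup>2 * T\<^sup>2 * (real (N n) * y\<^sup>2)" by simp
      also have "\<dots> \<le> K\<^sup>2 * T\<^sup>2 * (\<epsilon> * 1)"
      proof (rule mult_left_mono)
        have "\<epsilon> * \<epsilon> \<le> \<epsilon> * 1" using \<epsilon> \<epsilon>1 by (intro mult_left_mono) auto
        with Ny2' show "real (N n) * y\<^sup>2 \<le> \<epsilon> * 1" by (rule order_trans)
      qed simp
      finally have d: "real (N n) * (\<theta> n ^ 4 * (V (m n))\<^sup>2) \<le> K\<^sup>2 * T\<^sup>2 * \<epsilon>" by simp
      have "real (N n) * ((\<epsilon> * (\<theta> n)\<^sup>2 * V (m n) + \<theta> n ^ 4 * Q (m n) / \<epsilon>) / 12 + \<theta> n ^ 4 * (V (m n))\<^sup>2)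
        = (real (N n) * (\<epsilon> * ((\<theta> n)\<^sup>2 * V (m n))) + real (N n) * (\<theta> n ^ 4 * Q (m n) / \<epsilon>)) / 12
          + real (N n) * (\<theta> n ^ 4 * (V (m n))\<^sup>2)"
        by (simp add: algebra_simps add_divide_distrib)
      also have "\<dots> \<le> (K * T * \<epsilon> + B * T\<^sup>2 * \<epsilon>) / 12 + K\<^sup>2 * T\<^sup>2 * \<epsilon>"
        by (intro add_mono divide_right_mono a b d) simp
      also have "\<dots> = W * \<epsilon>" by (simp add: W_def algebra_simps add_divide_distrib)
      finally show ?thesis .
    qed
    ultimately show ?thesis unfolding n_eq[of n, symmetric] \<epsilon>_def by linarith
  qed
  have s1: "(\<lambda>n. real n powr (1/3) / sqrt (real n)) \<longlonglongrightarrow> 0" by real_asymp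
  have s2: "(\<lambda>n. 1 / sqrt (real n)) \<longlonglongrightarrow> 0" by real_asymp
  have Nge: "real n powr (1/3) - 1 \<le> real (N n)" for n
    using real_of_int_floor_gt_diff_one[of "real n powr (1/3)"] by (simp add: N_def)
  have "filterlim (\<lambda>n::nat. real n powr (1/3) - 1) at_top sequentially" by real_asymp
  then have "filterlim (\<lambda>n. real (N n)) at_top sequentially"
    by (rule filterlim_at_top_mono) (simp add: Nge)
  then have s3: "(\<lambda>n. 1 / sqrt (real (N n))) \<longlonglongrightarrow> 0"
    by (intro tendsto_divide_0[OF tendsto_const] filterlim_at_top_imp_at_infinity
          filterlim_compose[OF sqrt_at_top])
  have "(\<lambda>n. ((c + K) * (real n powr (1/3) / sqrt (real n)) + (V 0 + 1) * (1 / sqrt (real n))) * (\<bar>t\<bar> / sqrt v)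
        + W * (1 / sqrt (real (N n)))) \<longlonglongrightarrow> ((c + K) * 0 + (V 0 + 1) * 0) * (\<bar>t\<bar> / sqrt v) + W * 0"
    by (intro tendsto_add tendsto_mult tendsto_const s1 s2 s3)
  then have lim0: "(\<lambda>n. ((c + K) * (real n powr (1/3) / sqrt (real n)) + (V 0 + 1) * (1 / sqrt (real n))) * (\<bar>t\<bar> / sqrt v)
        + W * (1 / sqrt (real (N n)))) \<longlonglongrightarrow> 0" by simp
  have diff: "(\<lambda>n. \<phi> n (\<theta> n) - exp (- (real (N n) * ((\<theta> n)\<^sup>2 * V (m n) / 2)))) \<longlonglongrightarrow> 0"
    by (rule Lim_null_comparison[OF eventually_sequentiallyI[of 1] lim0]) (rule bound)
  \<comment> \<open>The variances of the blocks differ from \<open>v * m n\<close> by at most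
    \<open>C * sqrt n\<close> each, and the remainder omits fewer than \<open>N n\<close> letters;
    both totals are negligible against \<open>n\<close>.\<close>
  have "\<bar>real (N n) * V (m n) / real n - v\<bar> \<le> (C + v) * (real n powr (1/3) / sqrt (real n))" if n: "n \<ge> 1" for n
  proof -
    have npos: "real n > 0" using n by simp
    have "\<bar>V (m n) - v * real (m n)\<bar> \<le> C * real (m n) powr (1/2)" by (rule Vlin[OF m1[OF n]])
    also have "\<dots> \<le> C * sqrt (real n)"
      using C by (intro mult_left_mono) (auto simp: powr_half_sqrt m_def)
    finally have "real (N n) * \<bar>V (m n) - v * real (m n)\<bar> \<le> real n powr (1/3) * (C * sqrt (real n))"
      using Nle[of n] by (intro mult_mono) auto
    moreover have "v * real (r n) \<le> v * (real n powr (1/3) * sqrt (real n))"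
    proof (intro mult_left_mono)
      have "real (r n) \<le> real n powr (1/3) * 1" using rN[OF n] Nle[of n] by simp
      also have "\<dots> \<le> real n powr (1/3) * sqrt (real n)" using n by (intro mult_left_mono) auto
      finally show "real (r n) \<le> real n powr (1/3) * sqrt (real n)" .
    qed (use v in simp)
    moreover have "real (N n) * V (m n) - v * real n
        = real (N n) * (V (m n) - v * real (m n)) - v * real (r n)"
    proof -
      have "real n = real (r n) + real (N n) * real (m n)"
        by (subst n_eq[of n]) (simp only: of_nat_add of_nat_mult)
      then show ?thesis by (simp add: algebra_simps)
    qed
    then have "\<bar>real (N n) * V (m n) - v * real n\<bar> \<le> real (N n) * \<bar>V (m n) - v * real (m n)\<bar> + v * real (r n)"
      using v by (simp add: abs_mult order_trans[OF abs_triangle_ineq4])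
    ultimately have "\<bar>real (N n) * V (m n) - v * real n\<bar> \<le> (C + v) * (real n powr (1/3) * sqrt (real n))"
      by (simp add: algebra_simps)
    then have "\<bar>real (N n) * V (m n) - v * real n\<bar> / real n \<le> (C + v) * (real n powr (1/3) * sqrt (real n)) / real n"
      by (rule divide_right_mono) simp
    moreover have "sqrt (real n) / real n = 1 / sqrt (real n)" by (simp only: sqrt_divide_self_eq of_nat_0_le_iff inverse_eq_divide)
    moreover have "\<bar>real (N n) * V (m n) - v * real n\<bar> / real n = \<bar>real (N n) * V (m n) / real n - v\<bar>"
    proof -
      have "real (N n) * V (m n) / real n - v = (real (N n) * V (m n) - v * real n) / real n"
        using npos by (simp add: field_simps)
      then show ?thesis by simp
    qed
    moreover have "(C + v) * (real n powr (1/3) * sqrt (real n)) / real n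
        = (C + v) * (real n powr (1/3) * (sqrt (real n) / real n))" by simp
    ultimately have "\<bar>real (N n) * V (m n) / real n - v\<bar> \<le> (C + v) * (real n powr (1/3) * (1 / sqrt (real n)))"
      by (simp only:)
    then show ?thesis by simp
  qed
  then have "(\<lambda>n. real (N n) * V (m n) / real n - v) \<longlonglongrightarrow> 0"
    by (intro Lim_null_comparison[OF eventually_sequentiallyI[of 1]
          tendsto_mult_right_zero[OF s1, of "C + v"]]) simp
  then have "(\<lambda>n. real (N n) * V (m n) / real n) \<longlonglongrightarrow> v" by (simp only: LIM_zero_iff)
  then have "(\<lambda>n. - (T / 2 * (real (N n) * V (m n) / real n))) \<longlonglongrightarrow> - (T / 2 * v)"
    by (intro tendsto_intros)
  moreover have "T / 2 * v = t\<^sup>2 / 2" using v by (simp add: T_def)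
  moreover have "T / 2 * (real (N n) * V (m n) / real n) = real (N n) * ((\<theta> n)\<^sup>2 * V (m n) / 2)" for n
    by (simp add: \<theta>2 mult_ac)
  ultimately have "(\<lambda>n. - (real (N n) * ((\<theta> n)\<^sup>2 * V (m n) / 2))) \<longlonglongrightarrow> - (t\<^sup>2 / 2)" by (simp only:)
  then have "(\<lambda>n. complex_of_real (exp (- (real (N n) * ((\<theta> n)\<^sup>2 * V (m n) / 2))))) \<longlonglongrightarrow> of_real (exp (- (t\<^sup>2 / 2)))"
    by (intro tendsto_of_real tendsto_exp)
  from tendsto_add[OF diff this] show ?thesis unfolding \<theta>_def by simp
qed

end

section \<open>From characteristic functions to distribution functions\<close>

text \<open>The clt is phrased with a strict inequality, so weak convergence is applied to the open
  half-line, whose boundary point has normal measure 0; for the same reason its limit is the value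
  of the \<open>cdf\<close>.\<close>

lemma tendsto_of_char_tendsto:
  fixes p :: "nat \<Rightarrow> real pmf" and f :: "nat \<Rightarrow> real \<Rightarrow> real"
  assumes "\<And>t. (\<lambda>n. measure_pmf.expectation (p n) (\<lambda>x. iexp (t * f n x))) \<longlonglongrightarrow> exp (- (t\<^sup>2 / 2))"
  shows "(\<lambda>n. measure (measure_pmf (p n)) {x. f n x < t}) \<longlonglongrightarrow> cdf std_normal_distribution t"
proof -
  define M where "M n = distr (measure_pmf (p n)) borel (f n)" for n
  have M: "real_distribution (M n)" for n
    unfolding M_def by (rule prob_space.real_distribution_distr[OF measure_pmf.prob_space_axioms]) simp
  have S: "real_distribution std_normal_distribution" by (rule real_dist_normal_dist)
  interpret S: real_distribution std_normal_distribution by (rule S)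
  have "char (M n) t = measure_pmf.expectation (p n) (\<lambda>x. iexp (t * f n x))" for n t
    unfolding M_def char_def by (subst integral_distr) simp_all
  then have "(\<lambda>n. char (M n) t) \<longlonglongrightarrow> char std_normal_distribution t" for t
    using assms[of t] by (simp add: char_std_normal_distribution exp_of_real[symmetric])
  then have conv: "weak_conv_m M std_normal_distribution" by (rule levy_continuity[OF M S])
  have "{t} \<in> null_sets lborel" by (intro null_setsI) simp_all
  then have "{t} \<in> null_sets std_normal_distribution"
    using absolutely_continuousI_density[of "\<lambda>x. ennreal (std_normal_density x)" lborel]
    by (auto simp: absolutely_continuous_def)
  then have zero: "emeasure std_normal_distribution {t} = 0" by (rule null_setsD1)
  have "(\<lambda>n. measure (M n) {..<t}) \<longlonglongrightarrow> measure std_normal_distribution {..<t}"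
    by (rule weak_conv_imp_continuity_set_conv[OF M S conv]) (simp_all add: zero)
  moreover have "measure (M n) {..<t} = measure (measure_pmf (p n)) {x. f n x < t}" for n
    unfolding M_def by (subst measure_distr) (auto simp: vimage_def)
  moreover have "measure std_normal_distribution {..<t} = cdf std_normal_distribution t"
  proof -
    have "{..t} = {..<t} \<union> {t}" by auto
    then have "cdf std_normal_distribution t = measure std_normal_distribution {..<t} + measure std_normal_distribution {t}"
      unfolding cdf_def by (simp only:) (intro S.finite_measure_Union; simp)
    then show ?thesis using zero by (simp add: measure_def)
  qed
  ultimately show ?thesis by simp
qed

text \<open>The growth condition speaks of multiples of \<open>m\<close> because the combinatorial
  bound counts whole blocks; \<open>V_linear\<close> makes it a statement about the single constant
  \<open>v\<close>.\<close>

theorem (in almost_additive) almost_additive_clt: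
  assumes m: "m \<ge> 1" and \<delta>: "\<delta> > 0"
    and growth: "\<And>N. \<delta> * real N \<le> measure_pmf.variance (D (N * m)) (\<lambda>x. x)"
  shows "\<exists>\<mu> \<sigma>. \<sigma> > 0 \<and> (\<forall>t. (\<lambda>n. measure (measure_pmf (D n)) {x. x - \<mu> * real n < t * \<sigma> * sqrt (real n)})
    \<longlonglongrightarrow> cdf std_normal_distribution t)"
proof -
  define e where "e n = E n (\<lambda>x. x)" for n
  define D' where "D' n = map_pmf (\<lambda>x. x - e n) (D n)" for n
  define J' where "J' n m = map_pmf (\<lambda>(a, b, s). (a - e n, b - e m, s - e (n + m))) (J n m)" for n m
  interpret aa: almost_additive D' J' "2 * c"
    using centered unfolding D'_def J'_def e_def .
  interpret aa: almost_additive_centered D' J' "2 * c"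
    by unfold_locales (simp add: D'_def e_def)
  obtain v C where vC: "\<And>n. n \<ge> 1 \<Longrightarrow> \<bar>aa.V n - v * real n\<bar> \<le> C * real n powr (1/2)"
    using aa.V_linear by blast
  \<comment> \<open>Exponent 0: the means are linear up to a bounded error, so centering at
    \<open>\<mu> * n\<close> instead of \<open>e n\<close> is invisible after scaling.\<close>
  have "\<exists>\<mu> C. \<forall>n\<ge>1. \<bar>e n - \<mu> * real n\<bar> \<le> C * real n powr 0"
    by (rule almost_additive_linear[of 0 e c]) (use almost_additive_mean in \<open>simp_all add: e_def\<close>)
  then obtain \<mu> Ce where \<mu>: "\<And>n. n \<ge> 1 \<Longrightarrow> \<bar>e n - \<mu> * real n\<bar> \<le> Ce" by auto
  \<comment> \<open>Otherwise the variance at \<open>N * m\<close> would be at most of order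
    \<open>sqrt N\<close>, against the assumed growth in \<open>N\<close>.\<close>
  have v: "v > 0"
  proof (rule ccontr)
    assume "\<not> v > 0"
    obtain N where N: "real N > (C * sqrt (real m) / \<delta>)\<^sup>2" using reals_Archimedean2 by blast
    then have "N > 0" using le_less_trans[OF zero_le_power2] by (metis of_nat_0_less_iff)
    then have Nm: "N * m \<ge> 1" using m by simp
    have "\<delta> * real N \<le> aa.V (N * m)"
      using growth[of N] by (simp add: aa.V_def D'_def e_def)
    also have "\<dots> \<le> C * real (N * m) powr (1/2) + v * real (N * m)" using vC[OF Nm] by linarith
    also have "\<dots> \<le> C * real (N * m) powr (1/2)" using \<open>\<not> v > 0\<close> by (simp add: mult_nonpos_nonneg)
    also have "\<dots> = C * sqrt (real m) * sqrt (real N)" by (simp add: powr_half_sqrt real_sqrt_mult)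
    finally have "(\<delta> * sqrt (real N)) * sqrt (real N) \<le> (C * sqrt (real m)) * sqrt (real N)"
      by (simp add: mult.assoc)
    then have "\<delta> * sqrt (real N) \<le> C * sqrt (real m)"
      by (rule mult_right_le_imp_le) (simp add: \<open>N > 0\<close>)
    then have "sqrt (real N) \<le> C * sqrt (real m) / \<delta>" using \<delta> by (simp add: field_simps)
    then have "(sqrt (real N))\<^sup>2 \<le> (C * sqrt (real m) / \<delta>)\<^sup>2" by (rule power_mono) simp
    with N show False by simp
  qed
  define \<theta> where "\<theta> t n = t / (sqrt v * sqrt (real n))" for t and n :: nat
  have "(\<lambda>n. measure (measure_pmf (D n)) {x. (x - \<mu> * real n) / (sqrt v * sqrt (real n)) < t})
    \<longlonglongrightarrow> cdf std_normal_distribution t" for t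
  proof (rule tendsto_of_char_tendsto)
    fix t
    have lim0: "(\<lambda>n. \<bar>t\<bar> * Ce / sqrt v * (1 / sqrt (real n))) \<longlonglongrightarrow> 0"
      by (rule tendsto_mult_right_zero) real_asymp
    have "norm (\<theta> t n * (e n - \<mu> * real n)) \<le> \<bar>t\<bar> * Ce / sqrt v * (1 / sqrt (real n))" if "n \<ge> 1" for n
    proof -
      have "norm (\<theta> t n * (e n - \<mu> * real n)) \<le> \<bar>\<theta> t n\<bar> * Ce"
        unfolding real_norm_def abs_mult using \<mu>[OF that] by (intro mult_left_mono) auto
      then show ?thesis using v by (simp add: \<theta>_def abs_mult)
    qed
    then have "(\<lambda>n. \<theta> t n * (e n - \<mu> * real n)) \<longlonglongrightarrow> 0"
      by (rule Lim_null_comparison[OF eventually_sequentiallyI[of 1] lim0])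
    then have "(\<lambda>n. iexp (\<theta> t n * (e n - \<mu> * real n))) \<longlonglongrightarrow> iexp 0"
      by (intro tendsto_intros)
    moreover have "(\<lambda>n. aa.\<phi> n (\<theta> t n)) \<longlonglongrightarrow> exp (- (t\<^sup>2 / 2))"
      unfolding \<theta>_def by (rule aa.\<phi>_limit[OF v vC])
    ultimately have lim: "(\<lambda>n. iexp (\<theta> t n * (e n - \<mu> * real n)) * aa.\<phi> n (\<theta> t n)) \<longlonglongrightarrow> iexp 0 * exp (- (t\<^sup>2 / 2))"
      by (rule tendsto_mult)
    have "E n (\<lambda>x. iexp (t * ((x - \<mu> * real n) / (sqrt v * sqrt (real n)))))
        = iexp (\<theta> t n * (e n - \<mu> * real n)) * aa.\<phi> n (\<theta> t n)" for n
    proof -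
      have "iexp (t * ((x - \<mu> * real n) / (sqrt v * sqrt (real n))))
          = iexp (\<theta> t n * (e n - \<mu> * real n)) * iexp (\<theta> t n * (x - e n))" for x
      proof -
        have "t * ((x - \<mu> * real n) / (sqrt v * sqrt (real n))) = \<theta> t n * (e n - \<mu> * real n) + \<theta> t n * (x - e n)"
          by (simp add: \<theta>_def algebra_simps diff_divide_distrib add_divide_distrib)
        then show ?thesis by (simp only: of_real_add distrib_left exp_add)
      qed
      then show ?thesis by (simp add: aa.\<phi>_def D'_def)
    qed
    then show "(\<lambda>n. E n (\<lambda>x. iexp (t * ((x - \<mu> * real n) / (sqrt v * sqrt (real n))))))
        \<longlonglongrightarrow> exp (- (t\<^sup>2 / 2))"
      using lim by simp
  qed
  \<comment> \<open>The two events can differ at \<open>n = 0\<close>, where division by 0 yields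
    0.\<close>
  moreover have "\<forall>\<^sub>F n in sequentially.
      measure (measure_pmf (D n)) {x. (x - \<mu> * real n) / (sqrt v * sqrt (real n)) < t}
      = measure (measure_pmf (D n)) {x. x - \<mu> * real n < t * sqrt v * sqrt (real n)}" for t
  proof (rule eventually_sequentiallyI[of 1])
    fix n :: nat assume "1 \<le> n"
    then have "0 < sqrt v * sqrt (real n)" using v by simp
    then show "measure (measure_pmf (D n)) {x. (x - \<mu> * real n) / (sqrt v * sqrt (real n)) < t}
      = measure (measure_pmf (D n)) {x. x - \<mu> * real n < t * sqrt v * sqrt (real n)}"
      by (simp add: divide_less_eq mult.assoc)
  qed
  ultimately have "(\<lambda>n. measure (measure_pmf (D n)) {x. x - \<mu> * real n < t * sqrt v * sqrt (real n)})
      \<longlonglongrightarrow> cdf std_normal_distribution t" for t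
    by (rule Lim_transform_eventually)
  then show ?thesis using v by (intro exI[of _ \<mu>] exI[of _ "sqrt v"]) simp
qed

section \<open>Application to random permutations\<close>

theorem mainTheorem1:
  fixes r k :: nat and w :: "nat \<Rightarrow> (nat \<Rightarrow> nat) set"
  assumes pattern: "is_pattern r k w"
    and comb: "combinatorial r k w"
    and nondeg: "nondegenerate r k w"
  shows "satisfies_clt uniform_perm (\<lambda>n \<sigma>. real (longest_following r k w n \<sigma>))"
proof -
  define L where "L = longest_following r k w"
  define D where "D n = map_pmf (\<lambda>\<sigma>. real (L n \<sigma>)) (uniform_perm_pmf n)" for n
  \<comment> \<open>All three lengths are read off one permutation, so the cutting bounds hold
    pointwise.\<close>
  define J where "J n m = map_pmf (\<lambda>\<sigma>. (real (L n \<sigma>), real (L m (\<lambda>i. \<sigma> (n + i))), real (L (n + m) \<sigma>)))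
    (uniform_perm_pmf (n + m))" for n m
  interpret almost_additive D J "real k"
  proof
    fix n m
    show "finite (set_pmf (J n m))"
      unfolding J_def set_map_pmf set_uniform_perm_pmf by (intro finite_imageI finite_perms)
    have "map_pmf (\<lambda>(a, b, s). (a, b)) (J n m) = map_pmf (\<lambda>(a, b). (real a, real b))
        (map_pmf (\<lambda>\<sigma>. (L n \<sigma>, L m (\<lambda>i. \<sigma> (n + i)))) (uniform_perm_pmf (n + m)))"
      by (simp add: J_def map_pmf_comp)
    then show "map_pmf (\<lambda>(a, b, s). (a, b)) (J n m) = pair_pmf (D n) (D m)"
      by (simp only: L_def longest_following_blocks_indep map_pair D_def map_pmf_comp)
    show "map_pmf (\<lambda>(a, b, s). s) (J n m) = D (n + m)"
      by (simp add: J_def D_def map_pmf_comp)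
    fix a b s assume "(a, b, s) \<in> set_pmf (J n m)"
    then obtain \<sigma> where "a = real (L n \<sigma>)" "b = real (L m (\<lambda>i. \<sigma> (n + i)))" "s = real (L (n + m) \<sigma>)"
      by (auto simp: J_def)
    then show "\<bar>s - (a + b)\<bar> \<le> real k"
      using longest_following_superadditive[OF pattern comb, of n \<sigma> m]
        longest_following_subadditive[OF pattern, of n m \<sigma>] by (simp add: L_def)
  qed
  obtain m v v' where m: "m > 0" and v: "v permutes {1..m}" "v' permutes {1..m}"
    and spread: "longest_following r k w m v' + 4 * k < longest_following r k w m v"
    by (rule ex_large_spread[OF pattern nondeg, of "4 * k"])
  have growth: "1 / (2 * fact m) * real N \<le> measure_pmf.variance (D (N * m)) (\<lambda>x. x)" for N
  proof -
    define A where "A = real (card (perms (N * m)))"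
    have A: "A \<noteq> 0"
      unfolding A_def using perms_nonempty[of "N * m"] finite_perms[of "N * m"]
      by (simp only: of_nat_eq_0_iff card_eq_0_iff) blast
    have "measure_pmf.variance (D (N * m)) (\<lambda>x. x)
        = (\<Sum>\<sigma>\<in>perms (N * m). (real (L (N * m) \<sigma>) - E (N * m) (\<lambda>x. x))\<^sup>2) / A"
      unfolding D_def A_def by (simp only: integral_map_pmf) (rule integral_pmf_of_set[OF perms_nonempty finite_perms])
    also have "\<dots> \<ge> (A * real N / (2 * fact m)) / A"
      unfolding L_def A_def by (intro divide_right_mono longest_following_variance_ge[OF pattern comb v spread]) simp
    finally show ?thesis using A by simp
  qed
  obtain \<mu> \<sigma> where "\<sigma> > 0" and clt: "\<And>t. (\<lambda>n. measure (measure_pmf (D n)) {x. x - \<mu> * real n < t * \<sigma> * sqrt (real n)})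
    \<longlonglongrightarrow> cdf std_normal_distribution t"
    using almost_additive_clt[OF _ _ growth] m by auto
  moreover have "measure (measure_pmf (D n)) {x. x - \<mu> * real n < t * \<sigma> * sqrt (real n)}
      = measure (uniform_perm n) {x \<in> space (uniform_perm n).
          real (longest_following r k w n x) - \<mu> * real n < t * \<sigma> * sqrt (real n)}" for n t
    unfolding D_def measure_map_pmf uniform_perm_def L_def by (simp add: vimage_def)
  ultimately show ?thesis unfolding satisfies_clt_def by auto
qed

end
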